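(* Let $n\ge 2$ be an integer and let $\mathbb{F}$ be an algebraically closed field of characteristic $0$. Let $\Gamma\subset \mathrm{SL}^{\pm}(n+1,\mathbb{F})$ be an $\mathbb{F}$-Zariski-dense subgroup (that is, Zariski-dense in $\mathrm{SL}^{\pm}(n+1,\mathbb{F})$) generated by finitely many elements $\sigma_1,\dots,\sigma_m$. Let $\Delta$ be any subgroup of finite index in $\Gamma$. Let $\mathbb{A}$ be an integrally closed Noetherian ring in $\mathbb{F}$, and let $\mathbb{K}$ be the field of fractions of $\mathbb{A}$. Suppose that each $\sigma_i$, $i=1,\dots,m$, satisfies at least one of the following two conditions (possibly different ones for different $i$): - $\mathrm{tr}\,\sigma_i\ne 0$ and $\mathrm{tr}\,\sigma_i\in\mathbb{K}$; or - the order of $\sigma_i$ is finite and relatively prime to $n+1$. Then the following are equivalent: (a) $\Gamma$ is definable over $\mathbb{A}$; (b) $\Delta$ is definable over $\mathbb{A}$.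
   Context: $\mathrm{SL}^{\pm}(n+1,\mathbb{F})=\{A\in \mathrm{GL}(n+1,\mathbb{F}) : \det A=\pm1\}$. For a subring $\mathbb{A}$ of $\mathbb{F}$, an $\mathbb{A}$-lattice in $V=\mathbb{F}^{n+1}$ is a finitely generated $\mathbb{A}$-submodule $L\subset V$ such that the natural map $\mathbb{F}\otimes_{\mathbb{A}}L\to V$ is an isomorphism. A group of linear automorphisms of $V$ is definable over $\mathbb{A}$ if $V$ contains an $\mathbb{A}$-lattice invariant under it. *)

theory Defs
  imports
    "HOL-Analysis.Analysis"
    "HOL-Algebra.Free_Abelian_Groups"
    "HOL-Algebra.Ring_Divisibility"
    "HOL-Algebra.Algebraic_Closure_Type"
begin

section \<open>The group of matrices of determinant 1 or -1\<close>

definition SLpm :: "('a::field ^ 'n ^ 'n) monoid" where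
  "SLpm = \<lparr>carrier = {M. invertible M \<and> (det M = 1 \<or> det M = - 1)},
           monoid.mult = (\<lambda>M N. M ** N), one = mat 1\<rparr>"

lemma group_SLpm: "group (SLpm :: ('a::field ^ 'n ^ 'n) monoid)"
proof (rule groupI)
  fix M :: "'a ^ 'n ^ 'n"
  assume "M \<in> carrier SLpm"
  then have M: "invertible M" "det M = 1 \<or> det M = - 1"
    by (auto simp: SLpm_def)
  then obtain N where N: "M ** N = mat 1" "N ** M = mat 1"
    unfolding invertible_def by blast
  then have "det N * det M = 1"
    by (metis det_mul det_I)
  then have "det N = 1 \<or> det N = - 1"
    using M(2) by (metis minus_equation_iff mult.right_neutral mult_minus_right)
  moreover have "invertible N"
    using N unfolding invertible_def by blast
  ultimately show "\<exists>N \<in> carrier SLpm. N \<otimes>\<^bsub>SLpm\<^esub> M = \<one>\<^bsub>SLpm\<^esub>"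
    using N(2) by (auto simp: SLpm_def)
next
  fix M N :: "'a ^ 'n ^ 'n"
  assume "M \<in> carrier SLpm" "N \<in> carrier SLpm"
  then show "M \<otimes>\<^bsub>SLpm\<^esub> N \<in> carrier SLpm"
    by (auto simp: SLpm_def det_mul invertible_mult)
qed (auto simp: SLpm_def matrix_mul_assoc invertible_def)


section \<open>Zariski density\<close>

text \<open>The functions on the space of matrices that are polynomial in the matrix entries.\<close>

inductive_set matrix_poly_funs :: "('a::field ^ 'n ^ 'n \<Rightarrow> 'a) set" where
  const: "(\<lambda>_. c) \<in> matrix_poly_funs"
| entry: "(\<lambda>M. M $ i $ j) \<in> matrix_poly_funs"
| add: "p \<in> matrix_poly_funs \<Longrightarrow> q \<in> matrix_poly_funs \<Longrightarrow> (\<lambda>M. p M + q M) \<in> matrix_poly_funs"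
| mult: "p \<in> matrix_poly_funs \<Longrightarrow> q \<in> matrix_poly_funs \<Longrightarrow> (\<lambda>M. p M * q M) \<in> matrix_poly_funs"

definition zariski_closed :: "('a::field ^ 'n ^ 'n) set \<Rightarrow> bool" where
  "zariski_closed Z \<longleftrightarrow> (\<exists>P \<subseteq> matrix_poly_funs. Z = {M. \<forall>p\<in>P. p M = 0})"

text \<open>On \<^const>\<open>SLpm\<close> the determinant is its own inverse, so its Zariski topology as a linear
  algebraic group is the one induced from the affine space of all matrices.\<close>

definition zariski_dense_in ::
  "('a::field ^ 'n ^ 'n) set \<Rightarrow> ('a ^ 'n ^ 'n) set \<Rightarrow> bool" where
  "zariski_dense_in S T \<longleftrightarrow> S \<subseteq> T \<and> T \<subseteq> zariski_closed hull S"


section \<open>Subrings of a field\<close>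

text \<open>The ring structure induced on a subset of the ambient field; \<^const>\<open>ring_of_type_algebra\<close>
  is the ambient field itself, as a record.\<close>

definition ring_on :: "'a::field set \<Rightarrow> 'a ring" where
  "ring_on A = ring_of_type_algebra\<lparr>carrier := A\<rparr>"

definition fraction_field_in :: "'a::field set \<Rightarrow> 'a set" where
  "fraction_field_in A = {a / b |a b. a \<in> A \<and> b \<in> A \<and> b \<noteq> 0}"

text \<open>Integrally closed in the field of fractions, not in the ambient field.\<close>

definition integrally_closed :: "'a::field set \<Rightarrow> bool" where
  "integrally_closed A \<longleftrightarrow>
     (\<forall>x \<in> fraction_field_in A.
        (\<exists>p :: 'a poly. Polynomial.lead_coeff p = 1 \<and> (\<forall>i. Polynomial.coeff p i \<in> A) \<and> poly p x = 0)
        \<longrightarrow> x \<in> A)"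


section \<open>Lattices\<close>

definition submodule_over :: "'a::field set \<Rightarrow> ('a ^ 'n) set \<Rightarrow> bool" where
  "submodule_over A L \<longleftrightarrow>
     0 \<in> L \<and> (\<forall>v\<in>L. \<forall>w\<in>L. v + w \<in> L) \<and> (\<forall>a\<in>A. \<forall>v\<in>L. a *s v \<in> L)"

definition fin_gen_submodule :: "'a::field set \<Rightarrow> ('a ^ 'n) set \<Rightarrow> bool" where
  "fin_gen_submodule A L \<longleftrightarrow>
     submodule_over A L \<and> (\<exists>S. finite S \<and> L = submodule_over A hull S)"

text \<open>The tensor product over \<open>A\<close> of the ambient field \<open>F\<close> and \<open>L\<close>: the free Abelian group on
  the pairs in \<open>F \<times> L\<close>, modulo the subgroup generated by the relations of biadditivity and
  \<open>A\<close>-balancedness.\<close>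

definition tensor_relations :: "'a::field set \<Rightarrow> ('a ^ 'n) set \<Rightarrow> ('a \<times> ('a ^ 'n) \<Rightarrow>\<^sub>0 int) set" where
  "tensor_relations A L =
     {frag_of (c + d, v) - frag_of (c, v) - frag_of (d, v) |c d v. v \<in> L} \<union>
     {frag_of (c, v + w) - frag_of (c, v) - frag_of (c, w) |c v w. v \<in> L \<and> w \<in> L} \<union>
     {frag_of (c * a, v) - frag_of (c, a *s v) |c a v. a \<in> A \<and> v \<in> L}"

definition tensor_kernel :: "'a::field set \<Rightarrow> ('a ^ 'n) set \<Rightarrow> ('a \<times> ('a ^ 'n) \<Rightarrow>\<^sub>0 int) set" where
  "tensor_kernel A L = generate (free_Abelian_group (UNIV \<times> L)) (tensor_relations A L)"

definition tensor_product ::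
  "'a::field set \<Rightarrow> ('a ^ 'n) set \<Rightarrow> ('a \<times> ('a ^ 'n) \<Rightarrow>\<^sub>0 int) set monoid" where
  "tensor_product A L = free_Abelian_group (UNIV \<times> L) Mod tensor_kernel A L"

definition additive_space :: "('a::field ^ 'n) monoid" where
  "additive_space = \<lparr>carrier = UNIV, monoid.mult = (\<lambda>v w. v + w), one = 0\<rparr>"

definition tensor_eval :: "('a::field \<times> ('a ^ 'n) \<Rightarrow>\<^sub>0 int) \<Rightarrow> 'a ^ 'n" where
  "tensor_eval p =
     (\<Sum>(c, v) \<in> Poly_Mapping.keys p. of_int (Poly_Mapping.lookup p (c, v)) *s (c *s v))"

text \<open>The natural map sending the class of a pure tensor \<open>c \<otimes> v\<close> to \<open>c *s v\<close>. It is constant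
  on each coset, as \<open>tensor_map_coset\<close> below shows.\<close>

definition tensor_map :: "('a::field \<times> ('a ^ 'n) \<Rightarrow>\<^sub>0 int) set \<Rightarrow> 'a ^ 'n" where
  "tensor_map C = the_elem (tensor_eval ` C)"

text \<open>The natural map is linear over the ambient field, so it is an isomorphism of vector spaces
  if and only if it is one of additive groups.\<close>

definition lattice_over :: "'a::field set \<Rightarrow> ('a ^ 'n) set \<Rightarrow> bool" where
  "lattice_over A L \<longleftrightarrow>
     fin_gen_submodule A L \<and> tensor_map \<in> iso (tensor_product A L) additive_space"

definition definable_over :: "'a::field set \<Rightarrow> ('a ^ 'n ^ 'n) set \<Rightarrow> bool" where
  "definable_over A G \<longleftrightarrow> (\<exists>L. lattice_over A L \<and> (\<forall>g\<in>G. (\<lambda>v. g *v v) ` L \<subseteq> L))"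

lemma tensor_eval_superset:
  assumes "finite K" "Poly_Mapping.keys p \<subseteq> K"
  shows "tensor_eval p = (\<Sum>x\<in>K. of_int (Poly_Mapping.lookup p x) *s (fst x *s snd x))"
  unfolding tensor_eval_def case_prod_beta using assms
  by (intro sum.mono_neutral_cong_left) (auto simp: in_keys_iff)

lemma tensor_eval_add: "tensor_eval (p + q) = tensor_eval p + tensor_eval q"
proof -
  let ?K = "Poly_Mapping.keys p \<union> Poly_Mapping.keys q"
  have "Poly_Mapping.keys (p + q) \<subseteq> ?K"
    by (rule Poly_Mapping.keys_add)
  then show ?thesis
    by (simp add: tensor_eval_superset[of ?K] lookup_add vector_sadd_rdistrib distrib_right
        flip: sum.distrib)
qed

lemma tensor_eval_diff: "tensor_eval (p - q) = tensor_eval p - tensor_eval q"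
  using tensor_eval_add[of "p - q" q] by simp

lemma tensor_eval_of: "tensor_eval (frag_of (c, v)) = c *s v"
  by (simp add: tensor_eval_def)

lemma tensor_eval_0: "tensor_eval 0 = 0"
  by (simp add: tensor_eval_def)

lemma tensor_relations_carrier:
  assumes "submodule_over A L"
  shows "tensor_relations A L \<subseteq> carrier (free_Abelian_group (UNIV \<times> L))"
  using assms
  by (auto simp: tensor_relations_def submodule_over_def free_Abelian_group_def
      dest!: subsetD[OF keys_diff])

lemma tensor_eval_kernel:
  assumes "submodule_over A L" "x \<in> tensor_kernel A L"
  shows "tensor_eval x = 0"
proof -
  have rel: "tensor_eval r = 0" if "r \<in> tensor_relations A L" for r
    using that
    by (auto simp: tensor_relations_def tensor_eval_diff tensor_eval_of
        vector_sadd_rdistrib vector_add_ldistrib vector_smult_assoc)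
  show ?thesis
    using assms(2) unfolding tensor_kernel_def
  proof (induction rule: generate.induct)
    case (inv h)
    then have "inv\<^bsub>free_Abelian_group (UNIV \<times> L)\<^esub> h = - h"
      using tensor_relations_carrier[OF assms(1)]
      by (intro inv_free_Abelian_group) (auto simp: free_Abelian_group_def)
    then show ?case
      using rel[OF inv] tensor_eval_diff[of 0 h] by (simp add: tensor_eval_0)
  qed (auto simp: rel tensor_eval_0 tensor_eval_add free_Abelian_group_def)
qed

lemma tensor_map_coset:
  assumes "submodule_over A L"
  shows "tensor_map (tensor_kernel A L #>\<^bsub>free_Abelian_group (UNIV \<times> L)\<^esub> p) = tensor_eval p"
proof -
  have "0 \<in> tensor_kernel A L"
    unfolding tensor_kernel_def
    using generate.one[of "free_Abelian_group (UNIV \<times> L)"] by simp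
  then have "tensor_eval ` (tensor_kernel A L #>\<^bsub>free_Abelian_group (UNIV \<times> L)\<^esub> p) = {tensor_eval p}"
    using tensor_eval_kernel[OF assms]
    by (force simp: r_coset_def free_Abelian_group_def tensor_eval_add)
  then show ?thesis
    by (simp add: tensor_map_def)
qed

end

theory Submission
  imports Defs
begin

text \<open>Only the passage from \<open>\<Delta>\<close> to \<open>\<Gamma>\<close> has content. Let \<open>K\<close> be the fraction field of \<open>A\<close>. In a basis taken
  from a \<open>\<Delta>\<close>-invariant lattice, \<open>\<Delta>\<close> consists of matrices over \<open>K\<close>. For a generator \<open>s\<close> of \<open>\<Gamma>\<close>, the
  intersection \<open>D\<close> of \<open>\<Delta>\<close> with its conjugate by \<open>s\<close> still has finite index in \<open>\<Gamma>\<close>. By Zariski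
  density, \<open>D\<close> spans the full matrix algebra: otherwise a product of nonzero linear forms would vanish
  on \<open>\<Gamma>\<close>, hence on all matrices of determinant \<open>1\<close>, and by homogeneity on all matrices. Thus
  conjugation by \<open>s\<close> preserves the matrices over \<open>K\<close>, so \<open>s\<close> is a scalar multiple of one of them. The
  condition on the trace, or on the order together with the determinant, puts the scalar in \<open>K\<close>.
  So \<open>\<Gamma>\<close> acts over \<open>K\<close>, and the module generated by the \<open>\<Gamma>\<close>-translates of the lattice, of which
  finitely many are distinct, is a \<open>\<Gamma>\<close>-invariant lattice.

  Linear algebra over the subset \<open>K\<close> is reduced to linear algebra over the ambient field by a
  \<open>K\<close>-linear projection of the field onto \<open>K\<close>.\<close>

no_notation fps_nth (infixl "$" 75)

section \<open>Subfields\<close>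

text \<open>Closure under \<open>inverse\<close> needs no exception at zero, because
  \<open>inverse 0 = 0\<close>.\<close>

definition subfield_set :: "'a::field set \<Rightarrow> bool" where
  "subfield_set K \<longleftrightarrow> 1 \<in> K \<and> (\<forall>x\<in>K. \<forall>y\<in>K. x - y \<in> K \<and> x * y \<in> K \<and> inverse x \<in> K)"

lemma subfield_setD:
  assumes "subfield_set K"
  shows subfield_set_1: "1 \<in> K" and subfield_set_0: "0 \<in> K"
    and subfield_set_diff: "x \<in> K \<Longrightarrow> y \<in> K \<Longrightarrow> x - y \<in> K"
    and subfield_set_uminus: "x \<in> K \<Longrightarrow> - x \<in> K"
    and subfield_set_add: "x \<in> K \<Longrightarrow> y \<in> K \<Longrightarrow> x + y \<in> K"
    and subfield_set_mult: "x \<in> K \<Longrightarrow> y \<in> K \<Longrightarrow> x * y \<in> K"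
    and subfield_set_inverse: "x \<in> K \<Longrightarrow> inverse x \<in> K"
    and subfield_set_divide: "x \<in> K \<Longrightarrow> y \<in> K \<Longrightarrow> x / y \<in> K"
proof -
  show 1: "1 \<in> K" and d: "\<And>x y. x \<in> K \<Longrightarrow> y \<in> K \<Longrightarrow> x - y \<in> K"
    and m: "\<And>x y. x \<in> K \<Longrightarrow> y \<in> K \<Longrightarrow> x * y \<in> K" and i: "\<And>x. x \<in> K \<Longrightarrow> inverse x \<in> K"
    using assms unfolding subfield_set_def by auto
  show 0: "0 \<in> K" using d[OF 1 1] by simp
  show u: "- x \<in> K" if "x \<in> K" for x using d[OF 0 that] by simp
  show "x + y \<in> K" if "x \<in> K" "y \<in> K" for x y using d[OF that(1) u[OF that(2)]] by simp
  show "x / y \<in> K" if "x \<in> K" "y \<in> K" for x y using m[OF that(1) i[OF that(2)]]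
    by (simp add: divide_inverse)
qed

lemma subfield_set_sum:
  "subfield_set K \<Longrightarrow> (\<And>i. i \<in> I \<Longrightarrow> f i \<in> K) \<Longrightarrow> sum f I \<in> K"
  by (induction I rule: infinite_finite_induct) (auto intro: subfield_set_0 subfield_set_add)

lemma subfield_set_prod:
  "subfield_set K \<Longrightarrow> (\<And>i. i \<in> I \<Longrightarrow> f i \<in> K) \<Longrightarrow> prod f I \<in> K"
  by (induction I rule: infinite_finite_induct) (auto intro: subfield_set_1 subfield_set_mult)

lemma subfield_set_power: "subfield_set K \<Longrightarrow> x \<in> K \<Longrightarrow> x ^ k \<in> K"
  by (induction k) (auto intro: subfield_set_1 subfield_set_mult)

lemma subfield_set_coprime_powers:
  assumes K: "subfield_set K" and "x ^ k \<in> K" "x ^ l \<in> K" "coprime k l" "k \<noteq> 0"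
  shows "x \<in> K"
proof (cases "x = 0")
  case True
  then show ?thesis using subfield_set_0[OF K] by simp
next
  case False
  \<comment> \<open>Bezout over the natural numbers: two exponents divisible by \<open>k\<close> and
    by \<open>l\<close> that differ by exactly 1, so \<open>x\<close> is a quotient of
    powers.\<close>
  obtain a b where ab: "k * a = l * b + gcd k l"
    using bezout_nat[OF \<open>k \<noteq> 0\<close>] by metis
  then have "x ^ (k * a) = x ^ (l * b) * x"
    using \<open>coprime k l\<close> by simp
  then have "x = (x ^ k) ^ a / (x ^ l) ^ b"
    using False by (simp add: power_mult)
  then show ?thesis
    using assms by (metis subfield_set_divide subfield_set_power)
qed

text \<open>The kernel of the projection is a subspace maximal among those avoiding 1.\<close>

lemma subfield_set_projection:
  fixes K :: "'a::field set"
  assumes K: "subfield_set K"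
  obtains \<pi> :: "'a \<Rightarrow> 'a" where
    "\<And>x. \<pi> x \<in> K" "\<And>k. k \<in> K \<Longrightarrow> \<pi> k = k"
    "\<And>x y. \<pi> (x + y) = \<pi> x + \<pi> y" "\<And>k x. k \<in> K \<Longrightarrow> \<pi> (k * x) = k * \<pi> x"
proof -
  let ?sub = "\<lambda>H. 0 \<in> H \<and> (\<forall>x\<in>H. \<forall>y\<in>H. x + y \<in> H) \<and> (\<forall>k\<in>K. \<forall>x\<in>H. k * x \<in> H)"
  let ?A = "{H. ?sub H \<and> 1 \<notin> H}"
  note Ks = subfield_setD[OF K]
  have "\<exists>M\<in>?A. \<forall>Z\<in>?A. M \<subseteq> Z \<longrightarrow> Z = M"
  proof (rule subset_Zorn)
    fix C assume C: "subset.chain ?A C"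
    show "\<exists>U\<in>?A. \<forall>Z\<in>C. Z \<subseteq> U"
    proof (cases "C = {}")
      case True
      \<comment> \<open>The union of the empty chain is not a subspace, so the zero subspace serves
        as its upper bound.\<close>
      then show ?thesis by (intro bexI[of _ "{0}"]) auto
    next
      case False
      have sub: "\<And>H. H \<in> C \<Longrightarrow> ?sub H \<and> 1 \<notin> H"
        using C unfolding subset_chain_def by blast
      have lin: "\<And>Z Y. Z \<in> C \<Longrightarrow> Y \<in> C \<Longrightarrow> Z \<subseteq> Y \<or> Y \<subseteq> Z"
        using C unfolding subset_chain_def by simp
      have "?sub (\<Union>C)"
      proof (intro conjI ballI)
        from False obtain H where "H \<in> C" by blast
        with sub show "0 \<in> \<Union>C" by (meson UnionI)
      next
        fix x y assume "x \<in> \<Union>C" "y \<in> \<Union>C"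
        then obtain H1 H2 where H: "x \<in> H1" "H1 \<in> C" "y \<in> H2" "H2 \<in> C" by (meson UnionE)
        from lin[OF H(2,4)] show "x + y \<in> \<Union>C"
        proof
          assume "H1 \<subseteq> H2"
          with H sub[of H2] have "x + y \<in> H2" by (meson subsetD)
          with H(4) show ?thesis by (rule UnionI)
        next
          assume "H2 \<subseteq> H1"
          with H sub[of H1] have "x + y \<in> H1" by (meson subsetD)
          with H(2) show ?thesis by (rule UnionI)
        qed
      next
        fix k x assume "k \<in> K" "x \<in> \<Union>C"
              then obtain H where H: "x \<in> H" "H \<in> C" by (meson UnionE)
        with sub[of H] \<open>k \<in> K\<close> have "k * x \<in> H" by meson
        with H(2) show "k * x \<in> \<Union>C" by (rule UnionI)
      qed
      moreover have "1 \<notin> \<Union>C" using sub by (meson UnionE)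
      ultimately have "\<Union>C \<in> ?A" unfolding mem_Collect_eq by (rule conjI)
      then show ?thesis by (rule bexI[rotated]) (rule ballI, rule Union_upper)
    qed
  qed
  then obtain H where HA: "H \<in> ?A" and maxA: "\<forall>Z\<in>?A. H \<subseteq> Z \<longrightarrow> Z = H" by (rule bexE)
  have sH: "?sub H" and H4: "1 \<notin> H" using HA unfolding mem_Collect_eq by (rule conjunct1, rule conjunct2)
  have H: "0 \<in> H" "\<And>x y. x \<in> H \<Longrightarrow> y \<in> H \<Longrightarrow> x + y \<in> H"
    "\<And>k x. k \<in> K \<Longrightarrow> x \<in> H \<Longrightarrow> k * x \<in> H" "1 \<notin> H"
    using sH H4 by simp_all
  have max: "Z = H" if "?sub Z" "1 \<notin> Z" "H \<subseteq> Z" for Z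
    using maxA that(3) conjI[OF that(1,2)] unfolding Ball_def mem_Collect_eq by (elim allE[of _ Z] impE) assumption+
  have Hm: "- x \<in> H" if "x \<in> H" for x
    using H(3)[OF subfield_set_uminus[OF K Ks(1)] that] by simp
  have Hd: "x - y \<in> H" if "x \<in> H" "y \<in> H" for x y
    using H(2)[OF that(1) Hm[OF that(2)]] by simp
  \<comment> \<open>Together \<open>H\<close> and \<open>K\<close> span the field: if
    \<open>x\<close> is outside \<open>H\<close>, maximality puts 1 into the span of
    \<open>H\<close> and \<open>x\<close>. Solving \<open>1 = h + k * x\<close> for \<open>x\<close>
    leaves \<open>inverse k\<close> as its component in \<open>K\<close>.\<close>
  have ex: "\<exists>k\<in>K. x - k \<in> H" for x
  proof (cases "x \<in> H")
    case True
    then show ?thesis using Ks by (intro bexI[of _ 0]) auto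
  next
    case False
    let ?X = "{h + k * x | h k. h \<in> H \<and> k \<in> K}"
    have "x \<in> ?X" using H(1) Ks(1) by force
    then have ne: "?X \<noteq> H" using False by blast
    have HX: "H \<subseteq> ?X" using Ks(2) by force
    have sX: "?sub ?X"
    proof (intro conjI ballI)
      show "0 \<in> ?X" using H(1) HX by blast
      fix y z assume "y \<in> ?X" "z \<in> ?X"
      then obtain h k h' k' where e: "y = h + k * x" "z = h' + k' * x"
        "h \<in> H" "k \<in> K" "h' \<in> H" "k' \<in> K" by blast
      then have "y + z = (h + h') + (k + k') * x" by (simp add: algebra_simps)
      moreover have "h + h' \<in> H" "k + k' \<in> K" using e H(2) Ks(5) by simp_all
      ultimately show "y + z \<in> ?X" by blast
    next
      fix c y assume c: "c \<in> K" "y \<in> ?X"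
      then obtain h k where e: "y = h + k * x" "h \<in> H" "k \<in> K" by blast
      then have "c * y = c * h + (c * k) * x" by (simp add: algebra_simps)
      moreover have "c * h \<in> H" "c * k \<in> K" using e c H(3) Ks(6) by simp_all
      ultimately show "c * y \<in> ?X" by blast
    qed
    have "1 \<in> ?X" using max[OF sX _ HX] ne by blast
    then obtain h k where hk: "1 = h + k * x" "h \<in> H" "k \<in> K" by blast
    then have "k \<noteq> 0" using H(4) by auto
    have "inverse k = inverse k * (h + k * x)" using hk(1) by simp
    also have "\<dots> = inverse k * h + x" using \<open>k \<noteq> 0\<close> by (simp add: distrib_left flip: mult.assoc)
    finally have "inverse k = inverse k * h + x" .
    moreover have "x - a = - b" if "a = b + x" for a b using that by simp
    ultimately have "x - inverse k = - (inverse k * h)" by blast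
    moreover have "- (inverse k * h) \<in> H"
      by (rule Hm[OF H(3)[OF Ks(7)[OF hk(3)] hk(2)]])
    ultimately show ?thesis using Ks(7)[OF hk(3)] by (intro bexI[of _ "inverse k"]) auto
  qed
  define \<pi> where "\<pi> x = (SOME k. k \<in> K \<and> x - k \<in> H)" for x
  have \<pi>: "\<pi> x \<in> K" "x - \<pi> x \<in> H" for x
    using someI_ex[of "\<lambda>k. k \<in> K \<and> x - k \<in> H"] ex[of x] unfolding \<pi>_def by blast+
  \<comment> \<open>The sum of \<open>H\<close> and \<open>K\<close> is direct: a nonzero common
    element, multiplied by its inverse, would put 1 into \<open>H\<close>. Uniqueness then yields
    all the linearity claims.\<close>
  have uniq: "\<pi> x = k" if "k \<in> K" "x - k \<in> H" for x k
  proof (rule ccontr)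
    assume ne: "\<pi> x \<noteq> k"
    have "\<pi> x - k \<in> H" using Hd[OF that(2) \<pi>(2)[of x]] by simp
    then have "inverse (\<pi> x - k) * (\<pi> x - k) \<in> H"
      by (rule H(3)[OF Ks(7)[OF Ks(3)[OF \<pi>(1) that(1)]]])
    then show False using H(4) ne by simp
  qed
  show ?thesis
  proof
    show "\<pi> x \<in> K" for x by (rule \<pi>)
    show "\<pi> k = k" if "k \<in> K" for k using that H(1) by (intro uniq) auto
    show "\<pi> (x + y) = \<pi> x + \<pi> y" for x y
    proof (rule uniq)
      show "\<pi> x + \<pi> y \<in> K" by (rule Ks(5)[OF \<pi>(1) \<pi>(1)])
      show "x + y - (\<pi> x + \<pi> y) \<in> H" using H(2)[OF \<pi>(2)[of x] \<pi>(2)[of y]] by (simp add: algebra_simps)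
    qed
    show "\<pi> (k * x) = k * \<pi> x" if "k \<in> K" for k x
    proof (rule uniq)
      show "k * \<pi> x \<in> K" by (rule Ks(6)[OF that \<pi>(1)])
      show "k * x - (k * \<pi> x) \<in> H" using H(3)[OF that \<pi>(2)[of x]] by (simp add: algebra_simps)
    qed
  qed
qed

section \<open>The fraction field of a subring\<close>

lemma subring_ring_of_type_algebraD:
  fixes A :: "'a::field set"
  assumes "subring A (ring_of_type_algebra :: 'a ring)"
  shows "0 \<in> A" "1 \<in> A" "x \<in> A \<Longrightarrow> y \<in> A \<Longrightarrow> x + y \<in> A" "x \<in> A \<Longrightarrow> y \<in> A \<Longrightarrow> x * y \<in> A"
    "x \<in> A \<Longrightarrow> - x \<in> A"
proof -
  show o: "0 \<in> A" "1 \<in> A" and p: "\<And>x y. x \<in> A \<Longrightarrow> y \<in> A \<Longrightarrow> x + y \<in> A" and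
    "x \<in> A \<Longrightarrow> y \<in> A \<Longrightarrow> x * y \<in> A"
    using subringE(2,3,6,7)[OF assms] by (auto simp: ring_of_type_algebra_def)
  interpret R: Ring.ring "ring_of_type_algebra :: 'a ring"
    by (rule ring_from_type_algebra)
  have "\<ominus>\<^bsub>ring_of_type_algebra\<^esub> x = - x" for x :: 'a
    using R.r_neg[of x] by (simp add: ring_of_type_algebra_def add_eq_0_iff)
  then show "x \<in> A \<Longrightarrow> - x \<in> A" using subringE(5)[OF assms] by metis
qed

lemma fraction_field_in_subfield_set:
  fixes A :: "'a::field set"
  assumes "subring A (ring_of_type_algebra :: 'a ring)"
  shows "subfield_set (fraction_field_in A)" and "A \<subseteq> fraction_field_in A"
proof -
  note A = subring_ring_of_type_algebraD[OF assms]
  show AF: "A \<subseteq> fraction_field_in A"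
    using A(2) unfolding fraction_field_in_def by force
  show "subfield_set (fraction_field_in A)"
    unfolding subfield_set_def
  proof (intro conjI ballI)
    show "1 \<in> fraction_field_in A" using AF A by blast
    fix x y assume "x \<in> fraction_field_in A" "y \<in> fraction_field_in A"
    then obtain a b c d where e: "x = a / b" "y = c / d" "a \<in> A" "b \<in> A" "c \<in> A" "d \<in> A"
      "b \<noteq> 0" "d \<noteq> 0" unfolding fraction_field_in_def by blast
    have "x - y = (a * d + - (b * c)) / (b * d)"
      using e by (simp add: diff_frac_eq mult.commute)
    moreover have bd: "b * d \<noteq> 0" "b * d \<in> A" "a * d + - (b * c) \<in> A"
      using e A(4,5) A(3)[of "a * d" "- (b * c)"] by simp_all
    ultimately show "x - y \<in> fraction_field_in A" unfolding fraction_field_in_def by blast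
    have "x * y = (a * c) / (b * d)" "a * c \<in> A" using e A by auto
    with bd show "x * y \<in> fraction_field_in A"
      unfolding fraction_field_in_def by blast
    show "inverse x \<in> fraction_field_in A"
    proof (cases "a = 0")
      case True
      then show ?thesis using e A(1) AF by auto
    next
      case False
      then have "inverse x = b / a" using e by simp
      then show ?thesis using False e unfolding fraction_field_in_def by blast
    qed
  qed
qed

section \<open>Tensor products and lattices\<close>

lemma submodule_overD:
  assumes "submodule_over A L"
  shows "0 \<in> L" "v \<in> L \<Longrightarrow> w \<in> L \<Longrightarrow> v + w \<in> L" "a \<in> A \<Longrightarrow> v \<in> L \<Longrightarrow> a *s v \<in> L"
  using assms unfolding submodule_over_def by auto

lemma submodule_over_hull: "submodule_over A (submodule_over A hull S)"
  by (rule hull_in) (fastforce simp: submodule_over_def)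

text \<open>Every relation over \<open>L\<close> is a relation over \<open>L'\<close>. The delicate
  case is inversion, which is defined relative to the carrier; in both free groups it is
  negation.\<close>

lemma tensor_kernel_mono:
  assumes sub: "submodule_over A L" "submodule_over A L'" and "L \<subseteq> L'"
  shows "tensor_kernel A L \<subseteq> tensor_kernel A L'"
proof
  fix x assume "x \<in> tensor_kernel A L"
  then show "x \<in> tensor_kernel A L'"
    unfolding tensor_kernel_def
  proof (induction rule: generate.induct)
    case one
    then show ?case using generate.one[of "free_Abelian_group (UNIV \<times> L')"] by simp
  next
    case (incl h)
    then have "h \<in> tensor_relations A L'" using \<open>L \<subseteq> L'\<close> unfolding tensor_relations_def by blast
    then show ?case by (rule generate.incl)
  next
    case (inv h)
    then have h: "h \<in> tensor_relations A L'" using \<open>L \<subseteq> L'\<close> unfolding tensor_relations_def by blast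
    have "inv\<^bsub>free_Abelian_group (UNIV \<times> L)\<^esub> h = - h" "inv\<^bsub>free_Abelian_group (UNIV \<times> L')\<^esub> h = - h"
      using subsetD[OF tensor_relations_carrier[OF sub(1)] inv] subsetD[OF tensor_relations_carrier[OF sub(2)] h]
      by (simp_all add: carrier_free_Abelian_group_iff)
    then show ?case using generate.inv[OF h, of "free_Abelian_group (UNIV \<times> L')"] by simp
  next
    case (eng h1 h2)
    then show ?case using generate.eng[of h1 "free_Abelian_group (UNIV \<times> L')" _ h2] by simp
  qed
qed

section \<open>Cosets of the tensor kernel and a criterion for lattices\<close>

lemma tensor_kernel_subgroup:
  assumes "submodule_over A L"
  shows "subgroup (tensor_kernel A L) (free_Abelian_group (UNIV \<times> L))"
  unfolding tensor_kernel_def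
  by (rule group.generate_is_subgroup[OF group_free_Abelian_group tensor_relations_carrier[OF assms]])

lemma tensor_kernel_normal:
  assumes "submodule_over A L"
  shows "tensor_kernel A L \<lhd> free_Abelian_group (UNIV \<times> L)"
  by (rule comm_group.subgroup_imp_normal[OF abelian_free_Abelian_group tensor_kernel_subgroup[OF assms]])

lemma tensor_kernel_closed:
  assumes "submodule_over A L"
  shows "0 \<in> tensor_kernel A L"
    and "p \<in> tensor_kernel A L \<Longrightarrow> q \<in> tensor_kernel A L \<Longrightarrow> p + q \<in> tensor_kernel A L"
    and "p \<in> tensor_kernel A L \<Longrightarrow> q \<in> tensor_kernel A L \<Longrightarrow> p - q \<in> tensor_kernel A L"
proof -
  interpret S: subgroup "tensor_kernel A L" "free_Abelian_group (UNIV \<times> L)"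
    by (rule tensor_kernel_subgroup[OF assms])
  show "0 \<in> tensor_kernel A L" using S.one_closed by simp
  show add: "p + q \<in> tensor_kernel A L" if "p \<in> tensor_kernel A L" "q \<in> tensor_kernel A L" for p q
    using S.m_closed[OF that] by simp
  show "p - q \<in> tensor_kernel A L" if "p \<in> tensor_kernel A L" "q \<in> tensor_kernel A L"
  proof -
    have "inv\<^bsub>free_Abelian_group (UNIV \<times> L)\<^esub> q = - q"
      using S.subset that by (intro inv_free_Abelian_group) (auto simp: free_Abelian_group_def)
    then have "- q \<in> tensor_kernel A L" using S.m_inv_closed[OF that(2)] by simp
    from add[OF that(1) this] show ?thesis by simp
  qed
qed

lemma tensor_kernel_coset_eq_iff:
  assumes "submodule_over A L" and "p \<in> carrier (free_Abelian_group (UNIV \<times> L))"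
    "q \<in> carrier (free_Abelian_group (UNIV \<times> L))"
  shows "tensor_kernel A L #>\<^bsub>free_Abelian_group (UNIV \<times> L)\<^esub> p =
      tensor_kernel A L #>\<^bsub>free_Abelian_group (UNIV \<times> L)\<^esub> q \<longleftrightarrow> p - q \<in> tensor_kernel A L"
    (is "?l = ?r \<longleftrightarrow> _")
proof
  note cl = tensor_kernel_closed[OF assms(1)]
  have l: "?l = {h + p |h. h \<in> tensor_kernel A L}" and r: "?r = {h + q |h. h \<in> tensor_kernel A L}"
    by (auto simp: r_coset_def)
  show "p - q \<in> tensor_kernel A L" if "?l = ?r"
  proof -
    have "p \<in> ?l" unfolding l using cl(1) by force
    then have "p \<in> ?r" using that by simp
    then obtain h where "p = h + q" "h \<in> tensor_kernel A L" unfolding r by blast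
    then show ?thesis by simp
  qed
  show "?l = ?r" if pq: "p - q \<in> tensor_kernel A L"
  proof (intro equalityI subsetI)
    fix x assume "x \<in> ?l"
    then obtain h where h: "x = h + p" "h \<in> tensor_kernel A L" unfolding l by blast
    have "x = (h + (p - q)) + q" using h by simp
    then show "x \<in> ?r" unfolding r using cl(2)[OF h(2) pq] by blast
  next
    fix x assume "x \<in> ?r"
    then obtain h where h: "x = h + q" "h \<in> tensor_kernel A L" unfolding r by blast
    have "x = (h - (p - q)) + p" using h by simp
    then show "x \<in> ?l" unfolding l using cl(3)[OF h(2) pq] by blast
  qed
qed

text \<open>The natural map is additive on cosets, so being an isomorphism amounts to surjectivity
  and trivial kernel. Both are phrased on representatives, which removes the quotient from later
  arguments.\<close>

lemma lattice_over_iff: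
  "lattice_over A L \<longleftrightarrow> fin_gen_submodule A L \<and>
     (\<forall>v. \<exists>p \<in> carrier (free_Abelian_group (UNIV \<times> L)). tensor_eval p = v) \<and>
     (\<forall>p \<in> carrier (free_Abelian_group (UNIV \<times> L)). tensor_eval p = 0 \<longrightarrow> p \<in> tensor_kernel A L)"
proof (cases "fin_gen_submodule A L")
  case True
  then have sub: "submodule_over A L" unfolding fin_gen_submodule_def by blast
  let ?G = "free_Abelian_group (UNIV \<times> L)" and ?N = "tensor_kernel A L"
  interpret N: normal ?N ?G by (rule tensor_kernel_normal[OF sub])
  have carr: "carrier (tensor_product A L) = (\<lambda>p. ?N #>\<^bsub>?G\<^esub> p) ` carrier ?G"
    unfolding tensor_product_def by (auto simp: FactGroup_def RCOSETS_def)
  note ev = tensor_map_coset[OF sub]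
  have hom: "tensor_map \<in> hom (tensor_product A L) additive_space"
  proof (rule homI)
    fix C D assume "C \<in> carrier (tensor_product A L)" "D \<in> carrier (tensor_product A L)"
    then obtain p q where "C = ?N #>\<^bsub>?G\<^esub> p" "D = ?N #>\<^bsub>?G\<^esub> q" "p \<in> carrier ?G" "q \<in> carrier ?G"
      unfolding carr by blast
    moreover from this have "C \<otimes>\<^bsub>tensor_product A L\<^esub> D = ?N #>\<^bsub>?G\<^esub> (p + q)"
      using N.rcos_sum[of p q] by (simp add: tensor_product_def FactGroup_def)
    ultimately show "tensor_map (C \<otimes>\<^bsub>tensor_product A L\<^esub> D) = tensor_map C \<otimes>\<^bsub>additive_space\<^esub> tensor_map D"
      by (simp add: ev tensor_eval_add additive_space_def)
  qed (simp add: additive_space_def)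
  have diff: "p - q \<in> carrier ?G" if "p \<in> carrier ?G" "q \<in> carrier ?G" for p q
    using that keys_diff[of p q] by (auto simp: free_Abelian_group_def)
  have inj: "inj_on tensor_map (carrier (tensor_product A L)) \<longleftrightarrow>
      (\<forall>p \<in> carrier ?G. tensor_eval p = 0 \<longrightarrow> p \<in> ?N)" (is "?I \<longleftrightarrow> ?Z")
  proof
    assume I: ?I
    show ?Z
    proof (intro ballI impI)
      fix p assume p: "p \<in> carrier ?G" "tensor_eval p = 0"
      have z: "0 \<in> carrier ?G" by (simp add: free_Abelian_group_def)
      have "?N #>\<^bsub>?G\<^esub> p = ?N #>\<^bsub>?G\<^esub> 0"
        by (rule inj_onD[OF I]) (use p z in \<open>auto simp: ev carr tensor_eval_0\<close>)
      then show "p \<in> ?N" using tensor_kernel_coset_eq_iff[OF sub p(1) z] by simp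
    qed
  next
    assume Z: ?Z
    show ?I
      unfolding carr
    proof (rule inj_onI, elim imageE, hypsubst)
      fix p q assume pq: "p \<in> carrier ?G" "q \<in> carrier ?G"
        and "tensor_map (?N #>\<^bsub>?G\<^esub> p) = tensor_map (?N #>\<^bsub>?G\<^esub> q)"
      then have "tensor_eval (p - q) = 0" by (simp add: ev tensor_eval_diff)
      then have "p - q \<in> ?N" using Z diff[OF pq] by blast
      then show "?N #>\<^bsub>?G\<^esub> p = ?N #>\<^bsub>?G\<^esub> q" using tensor_kernel_coset_eq_iff[OF sub pq] by simp
    qed
  qed
  have surj: "tensor_map ` carrier (tensor_product A L) = UNIV \<longleftrightarrow>
      (\<forall>v. \<exists>p \<in> carrier ?G. tensor_eval p = v)"
    unfolding carr image_image ev set_eq_iff image_iff by (simp add: eq_commute)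
  have cS: "carrier additive_space = (UNIV :: ('a ^ 'b) set)" by (simp add: additive_space_def)
  show ?thesis
    using True hom inj surj cS unfolding lattice_over_def iso_def bij_betw_def by auto
qed (simp add: lattice_over_def)

text \<open>The additive extension of \<open>g\<close> from the free generators to the free Abelian
  group; a ring-valued counterpart of \<open>tensor_eval\<close>.\<close>

definition frag_sum :: "('x \<Rightarrow> 'a::ring_1) \<Rightarrow> ('x \<Rightarrow>\<^sub>0 int) \<Rightarrow> 'a" where
  "frag_sum g p = (\<Sum>x\<in>Poly_Mapping.keys p. of_int (Poly_Mapping.lookup p x) * g x)"

lemma frag_sum_superset:
  assumes "finite K" "Poly_Mapping.keys p \<subseteq> K"
  shows "frag_sum g p = (\<Sum>x\<in>K. of_int (Poly_Mapping.lookup p x) * g x)"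
  unfolding frag_sum_def using assms
  by (intro sum.mono_neutral_cong_left) (auto simp: in_keys_iff)

lemma frag_sum_add: "frag_sum g (p + q) = frag_sum g p + frag_sum g q"
proof -
  let ?K = "Poly_Mapping.keys p \<union> Poly_Mapping.keys q"
  have "Poly_Mapping.keys (p + q) \<subseteq> ?K"
    by (rule Poly_Mapping.keys_add)
  then show ?thesis
    by (simp add: frag_sum_superset[of ?K] lookup_add distrib_right flip: sum.distrib)
qed

lemma frag_sum_diff: "frag_sum g (p - q) = frag_sum g p - frag_sum g q"
  using frag_sum_add[of g "p - q" q] by simp

lemma frag_sum_of: "frag_sum g (frag_of x) = g x"
  by (simp add: frag_sum_def)

lemma frag_sum_0: "frag_sum g 0 = 0"
  by (simp add: frag_sum_def)

lemma frag_sum_sum: "frag_sum g (\<Sum>j\<in>J. p j) = (\<Sum>j\<in>J. frag_sum g (p j))"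
  by (induction J rule: infinite_finite_induct) (auto simp: frag_sum_0 frag_sum_add)

text \<open>The universal property of the tensor product: an additive extension that kills the
  defining relations is well defined on cosets.\<close>

lemma frag_sum_tensor_kernel:
  assumes sub: "submodule_over A L"
    and rel: "\<And>r. r \<in> tensor_relations A L \<Longrightarrow> frag_sum g r = 0"
    and "x \<in> tensor_kernel A L"
  shows "frag_sum g x = 0"
  using assms(3) unfolding tensor_kernel_def
proof (induction rule: generate.induct)
  case (inv h)
  then have "inv\<^bsub>free_Abelian_group (UNIV \<times> L)\<^esub> h = - h"
    using tensor_relations_carrier[OF sub]
    by (intro inv_free_Abelian_group) (auto simp: free_Abelian_group_def)
  then show ?case
    using rel[OF inv] frag_sum_diff[of g 0 h] by (simp add: frag_sum_0)
qed (auto simp: rel frag_sum_0 frag_sum_add)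

text \<open>An \<open>A\<close>-linear functional on the lattice induces one on the tensor product, hence, by
  injectivity of the natural map, one on the ambient space.\<close>

lemma lattice_over_functional:
  fixes \<phi> :: "'a::field ^ 'n \<Rightarrow> 'a" and e :: "'j \<Rightarrow> 'a ^ 'n"
  assumes L: "lattice_over A L"
    and add: "\<And>v w. v \<in> L \<Longrightarrow> w \<in> L \<Longrightarrow> \<phi> (v + w) = \<phi> v + \<phi> w"
    and scale: "\<And>a v. a \<in> A \<Longrightarrow> v \<in> L \<Longrightarrow> \<phi> (a *s v) = a * \<phi> v"
    and e: "\<And>j. j \<in> J \<Longrightarrow> e j \<in> L" and v: "v \<in> L" and eq: "v = (\<Sum>j\<in>J. c j *s e j)"
  shows "\<phi> v = (\<Sum>j\<in>J. c j * \<phi> (e j))"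
proof -
  have sub: "submodule_over A L" using L unfolding lattice_over_def fin_gen_submodule_def by blast
  let ?G = "free_Abelian_group (UNIV \<times> L) :: ('a \<times> ('a ^ 'n) \<Rightarrow>\<^sub>0 int) monoid"
  have sumG: "(\<Sum>j\<in>J'. frag_of (c j, e j)) \<in> carrier ?G" if "J' \<subseteq> J" for J'
    using that
  proof (induction J' rule: infinite_finite_induct)
    case (insert j J')
    then have "frag_of (c j, e j) \<in> carrier ?G" using e by (auto simp: free_Abelian_group_def)
    then show ?case using insert Poly_Mapping.keys_add[of "frag_of (c j, e j)" "\<Sum>j\<in>J'. frag_of (c j, e j)"]
      by (auto simp: free_Abelian_group_def)
  qed (auto simp: free_Abelian_group_def)
  have evsum: "tensor_eval (\<Sum>j\<in>J'. frag_of (c j, e j)) = (\<Sum>j\<in>J'. c j *s e j)" for J'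
    by (induction J' rule: infinite_finite_induct)
      (auto simp: tensor_eval_0 tensor_eval_add tensor_eval_of)
  \<comment> \<open>The given relation among vectors, lifted to formal tensors. It evaluates to
    zero, so injectivity of the natural map places it in the tensor kernel.\<close>
  define p :: "'a \<times> ('a ^ 'n) \<Rightarrow>\<^sub>0 int" where "p = frag_of (1, v) - (\<Sum>j\<in>J. frag_of (c j, e j))"
  have "p \<in> carrier ?G"
    using sumG[of J] v keys_diff[of "frag_of (1, v)" "\<Sum>j\<in>J. frag_of (c j, e j)"]
    by (auto simp: p_def free_Abelian_group_def)
  moreover have "tensor_eval p = 0"
    by (simp add: p_def tensor_eval_diff evsum tensor_eval_of eq)
  ultimately have "p \<in> tensor_kernel A L" using L unfolding lattice_over_iff by blast
  \<comment> \<open>The functional on pure tensors sending \<open>c \<otimes> v\<close> to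
    \<open>c * \<phi> v\<close>; it respects the relations by \<open>A\<close>-linearity of
    \<open>\<phi>\<close> on \<open>L\<close>.\<close>
  define g where "g x = fst x * \<phi> (snd x)" for x
  have "frag_sum g r = 0" if "r \<in> tensor_relations A L" for r
    using that submodule_overD[OF sub] add scale
    by (auto simp: tensor_relations_def frag_sum_diff frag_sum_of g_def distrib_left distrib_right mult.assoc)
  from frag_sum_tensor_kernel[OF sub this \<open>p \<in> tensor_kernel A L\<close>] show ?thesis
    by (simp add: p_def frag_sum_diff frag_sum_sum frag_sum_of g_def)
qed

text \<open>By balancing, \<open>c \<otimes> v\<close> equals
  \<open>(c / d) \<otimes> (d *s v)\<close>, so every tensor over \<open>L'\<close> has a
  representative over \<open>L\<close>. Triviality of the kernel is thus inherited from
  \<open>L\<close>, and surjectivity holds already on \<open>L\<close>.\<close>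

lemma lattice_over_commensurable:
  assumes L: "lattice_over A L" and fg: "fin_gen_submodule A L'" and "L \<subseteq> L'"
    and d: "d \<in> A" "d \<noteq> 0" "\<And>v. v \<in> L' \<Longrightarrow> d *s v \<in> L"
  shows "lattice_over A L'"
proof -
  have sub: "submodule_over A L" and sub': "submodule_over A L'"
    using L fg unfolding lattice_over_def fin_gen_submodule_def by blast+
  let ?G = "free_Abelian_group (UNIV \<times> L)" and ?G' = "free_Abelian_group (UNIV \<times> L')"
  have GG: "carrier ?G \<subseteq> carrier ?G'"
    using \<open>L \<subseteq> L'\<close> by (auto simp: free_Abelian_group_def)
  note cl = tensor_kernel_closed[OF sub']
  have red: "\<exists>q\<in>carrier ?G. p - q \<in> tensor_kernel A L'" if "p \<in> carrier ?G'" for p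
  proof -
    have "Poly_Mapping.keys p \<subseteq> UNIV \<times> L'" using that by (simp add: free_Abelian_group_def)
    then show ?thesis
    proof (induction p rule: frag_induction)
      case zero
      then show ?case using cl(1) by (intro bexI[of _ 0]) (auto simp: free_Abelian_group_def)
    next
      case (one x)
      obtain c v where x: "x = (c, v)" by (cases x)
      then have v: "v \<in> L'" using one by simp
      let ?q = "frag_of (c / d, d *s v)"
      have "frag_of (c / d * d, v) - ?q \<in> tensor_relations A L'"
        using d v unfolding tensor_relations_def by blast
      then have "frag_of x - ?q \<in> tensor_kernel A L'"
        using d unfolding tensor_kernel_def x by (simp add: generate.incl)
      moreover have "?q \<in> carrier ?G" using d v by (simp add: free_Abelian_group_def)
      ultimately show ?case by blast
    next
      case (diff a b)
      then obtain q r where q: "q \<in> carrier ?G" "a - q \<in> tensor_kernel A L'"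
        and r: "r \<in> carrier ?G" "b - r \<in> tensor_kernel A L'" by blast
      have "(a - b) - (q - r) = (a - q) - (b - r)" by (simp add: algebra_simps)
      then have "(a - b) - (q - r) \<in> tensor_kernel A L'" using cl(3)[OF q(2) r(2)] by metis
      moreover have "q - r \<in> carrier ?G"
        using q r keys_diff[of q r] by (auto simp: free_Abelian_group_def)
      ultimately show ?case by blast
    qed
  qed
  show ?thesis
    unfolding lattice_over_iff
  proof (intro conjI fg allI ballI impI)
    fix v show "\<exists>p\<in>carrier ?G'. tensor_eval p = v"
      using L GG unfolding lattice_over_iff by blast
  next
    fix p assume p: "p \<in> carrier ?G'" "tensor_eval p = 0"
    obtain q where q: "q \<in> carrier ?G" "p - q \<in> tensor_kernel A L'" using red[OF p(1)] by blast
    have "tensor_eval q = 0"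
      using tensor_eval_kernel[OF sub' q(2)] p(2) by (simp add: tensor_eval_diff)
    then have "q \<in> tensor_kernel A L" using L q(1) unfolding lattice_over_iff by blast
    then have "q \<in> tensor_kernel A L'" using tensor_kernel_mono[OF sub sub' \<open>L \<subseteq> L'\<close>] by blast
    with q(2) show "p \<in> tensor_kernel A L'" using cl(2)[of "p - q" q] by simp
  qed
qed

text \<open>Surjectivity of the natural map writes each vector as the value of a formal sum, which
  is a linear combination of elements of \<open>L\<close>.\<close>

lemma lattice_over_span:
  assumes "lattice_over A L"
  shows "vec.span L = UNIV"
proof (rule UNIV_eq_I[symmetric])
  fix v
  obtain p where p: "p \<in> carrier (free_Abelian_group (UNIV \<times> L))" "tensor_eval p = v"
    using assms unfolding lattice_over_iff by blast
  have "tensor_eval p \<in> vec.span L"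
    unfolding tensor_eval_def case_prod_beta
    using p(1) by (intro vec.span_sum vec.span_scale vec.span_base) (auto simp: free_Abelian_group_def)
  then show "v \<in> vec.span L" using p by simp
qed

section \<open>Trace forms and Zariski density\<close>

text \<open>The product of the polynomials is nonzero and has finitely many roots, while a field of
  characteristic 0 is infinite.\<close>

lemma exists_common_non_root:
  fixes P :: "'a::field_char_0 poly set"
  assumes "finite P" "0 \<notin> P"
  shows "\<exists>x. \<forall>p\<in>P. poly p x \<noteq> 0"
proof -
  have "\<Prod>P \<noteq> 0" using assms by (auto simp: prod_zero_iff)
  then have "finite {x. poly (\<Prod>P) x = 0}" by (rule poly_roots_finite)
  then obtain x where "poly (\<Prod>P) x \<noteq> 0"
    using infinite_UNIV_char_0[where 'a='a] by (metis (mono_tags) UNIV_eq_I mem_Collect_eq)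
  then have "\<forall>p\<in>P. poly p x \<noteq> 0" using assms(1) by (auto simp: poly_prod prod_zero_iff)
  then show ?thesis ..
qed

text \<open>The Leibniz formula, read in the polynomial ring and then evaluated.\<close>

lemma det_polynomial_entries:
  fixes q :: "'n::finite \<Rightarrow> 'n \<Rightarrow> 'a::field poly"
  shows "\<exists>p. \<forall>s. poly p s = det (\<chi> i j. poly (q i j) s)"
proof -
  let ?p = "\<Sum>\<pi> | \<pi> permutes (UNIV :: 'n set). of_int (sign \<pi>) * (\<Prod>i\<in>UNIV. q i (\<pi> i))"
  have "poly ?p s = det (\<chi> i j. poly (q i j) s)" for s
    by (simp add: det_def poly_sum poly_prod)
  then show ?thesis by blast
qed

text \<open>Nondegeneracy of the trace form: multiplying by the matrix unit at \<open>(j, i)\<close>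
  extracts the entry \<open>B $ i $ j\<close>.\<close>

lemma trace_mult_nonzero:
  fixes B :: "'a::field ^ 'n ^ 'n"
  assumes "B \<noteq> 0"
  shows "\<exists>M. trace (B ** M) \<noteq> 0"
proof -
  obtain i j where ij: "B $ i $ j \<noteq> 0" using assms by (auto simp: vec_eq_iff)
  have "trace (B ** (\<chi> a b. if a = j \<and> b = i then 1 else 0)) =
      (\<Sum>a\<in>UNIV. \<Sum>c\<in>UNIV. if a = i \<and> c = j then B $ i $ j else 0)"
    unfolding trace_def matrix_matrix_mult_def by (auto intro!: sum.cong)
  also have "\<dots> = (\<Sum>a\<in>UNIV. if a = i then B $ i $ j else 0)"
    by (intro sum.cong refl) (auto simp: sum.delta)
  also have "\<dots> = B $ i $ j" by simp
  finally show ?thesis using ij by metis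
qed

lemma trace_mult_expand:
  fixes B M :: "'a::field ^ 'n ^ 'n"
  shows "trace (B ** M) = (\<Sum>i\<in>UNIV. \<Sum>k\<in>UNIV. B $ i $ k * M $ k $ i)"
  by (simp add: trace_def matrix_matrix_mult_def)

lemma trace_mult_affine:
  fixes B M N :: "'a::field ^ 'n ^ 'n"
  shows "trace (B ** (\<chi> i j. M $ i $ j + s * N $ i $ j)) = trace (B ** M) + s * trace (B ** N)"
  by (simp add: trace_mult_expand sum.distrib sum_distrib_left algebra_simps)

text \<open>On the line through \<open>M\<close> with direction \<open>M0\<close>, each form becomes
  a polynomial of degree at most 1. The old forms have nonzero constant term and the new one has
  nonzero slope, so some parameter avoids all roots.\<close>

lemma trace_forms_common_nonzero:
  fixes S :: "('a::field_char_0 ^ 'n ^ 'n) set"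
  assumes "finite S" "0 \<notin> S"
  shows "\<exists>M. \<forall>B\<in>S. trace (B ** M) \<noteq> 0"
  using assms
proof (induction S rule: finite_induct)
  case (insert B0 S)
  then obtain M where M: "\<And>B. B \<in> S \<Longrightarrow> trace (B ** M) \<noteq> 0" by auto
  obtain M0 where M0: "trace (B0 ** M0) \<noteq> 0" using trace_mult_nonzero[of B0] insert by auto
  let ?q = "\<lambda>B. [:trace (B ** M), trace (B ** M0):]"
  have "0 \<notin> ?q ` insert B0 S" using M M0 by auto
  then obtain s where s: "\<And>p. p \<in> ?q ` insert B0 S \<Longrightarrow> poly p s \<noteq> 0"
    using exists_common_non_root[of "?q ` insert B0 S"] insert(1) by blast
  have "trace (B ** (\<chi> i j. M $ i $ j + s * M0 $ i $ j)) \<noteq> 0" if "B \<in> insert B0 S" for B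
    using s[of "?q B"] that unfolding trace_mult_affine by auto
  then show ?case by blast
qed auto

text \<open>Homogeneity of the trace forms allows rescaling to determinant 1, using roots of the
  determinant.\<close>

lemma trace_forms_common_nonzero_SLpm:
  fixes S :: "('a::{alg_closed_field, field_char_0} ^ 'n ^ 'n) set"
  assumes "finite S" "0 \<notin> S"
  shows "\<exists>M\<in>carrier SLpm. \<forall>B\<in>S. trace (B ** M) \<noteq> 0"
proof -
  obtain M where M: "\<And>B. B \<in> S \<Longrightarrow> trace (B ** M) \<noteq> 0"
    using trace_forms_common_nonzero[OF assms] by blast
  let ?N = "\<lambda>s. (\<chi> i j. (mat 1 :: 'a ^ 'n ^ 'n) $ i $ j + s * M $ i $ j)"
  obtain d where "\<And>s. poly d s = det (\<chi> i j. poly [:(mat 1 :: 'a ^ 'n ^ 'n) $ i $ j, M $ i $ j:] s)"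
    using det_polynomial_entries[of "\<lambda>i j. [:(mat 1 :: 'a ^ 'n ^ 'n) $ i $ j, M $ i $ j:]"] by blast
  then have d: "poly d s = det (?N s)" for s by simp
  \<comment> \<open>Starting the line at the identity makes the determinant a polynomial with value
    1 at 0, hence nonzero; its roots can be avoided together with those of the forms.\<close>
  have "?N 0 = mat 1" by (simp add: vec_eq_iff)
  then have "poly d 0 = 1" using d[of 0] by simp
  then have "d \<noteq> 0" by auto
  let ?q = "\<lambda>B. [:trace (B ** mat 1), trace (B ** M):]"
  have "0 \<notin> insert d (?q ` S)" using M \<open>d \<noteq> 0\<close> by auto
  then obtain s where s: "\<And>p. p \<in> insert d (?q ` S) \<Longrightarrow> poly p s \<noteq> 0"
    using exists_common_non_root[of "insert d (?q ` S)"] assms(1) by blast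
  let ?M = "?N s"
  have det: "det ?M \<noteq> 0" using s[of d] d by simp
  have tr: "trace (B ** ?M) \<noteq> 0" if "B \<in> S" for B
    using s[of "?q B"] that unfolding trace_mult_affine by simp
  obtain l where l: "l ^ CARD('n) = inverse (det ?M)"
    using nth_root_exists[of "CARD('n)" "inverse (det ?M)"] by auto
  have "l \<noteq> 0"
  proof
    assume "l = 0"
    then have "l ^ CARD('n) = 0" by (simp add: zero_power)
    then have "inverse (det ?M) = 0" using l by simp
    then show False using det nonzero_imp_inverse_nonzero by blast
  qed
  let ?L = "\<chi> i. l *s ?M $ i"
  have "det ?L = 1"
    using det_rows_mul[of "\<lambda>_. l" "\<lambda>i. ?M $ i"] l det by simp
  then have "?L \<in> carrier SLpm" by (simp add: SLpm_def invertible_det_nz)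
  moreover have "trace (B ** ?L) = l * trace (B ** ?M)" for B
    by (simp add: trace_mult_expand sum_distrib_left mult.left_commute)
  then have "trace (B ** ?L) \<noteq> 0" if "B \<in> S" for B using tr[OF that] \<open>l \<noteq> 0\<close> by simp
  ultimately show ?thesis by blast
qed

section \<open>Consequences of Zariski density\<close>

lemma matrix_poly_funs_sum:
  "(\<And>i. i \<in> I \<Longrightarrow> f i \<in> matrix_poly_funs) \<Longrightarrow> (\<lambda>M. \<Sum>i\<in>I. f i M) \<in> matrix_poly_funs"
  by (induction I rule: infinite_finite_induct)
    (auto intro: matrix_poly_funs.const matrix_poly_funs.add)

lemma matrix_poly_funs_prod:
  "(\<And>i. i \<in> I \<Longrightarrow> f i \<in> matrix_poly_funs) \<Longrightarrow> (\<lambda>M. \<Prod>i\<in>I. f i M) \<in> matrix_poly_funs"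
  by (induction I rule: infinite_finite_induct)
    (auto intro: matrix_poly_funs.const matrix_poly_funs.mult)

text \<open>If every element of \<open>G\<close> killed some form, the product of the forms would be
  a polynomial function vanishing on \<open>G\<close>, hence by density on all of
  \<open>SLpm\<close>. A common non-zero in \<open>SLpm\<close> rules this out.\<close>

lemma zariski_dense_trace_forms:
  fixes S :: "('a::{alg_closed_field, field_char_0} ^ 'n ^ 'n) set"
  assumes dense: "zariski_dense_in G (carrier SLpm)" and S: "finite S" "0 \<notin> S"
  shows "\<exists>g\<in>G. \<forall>B\<in>S. trace (B ** g) \<noteq> 0"
proof (rule ccontr)
  assume none: "\<not> ?thesis"
  define p where "p M = (\<Prod>B\<in>S. trace (B ** M))" for M
  have "p \<in> matrix_poly_funs"
    unfolding p_def trace_mult_expand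
    by (intro matrix_poly_funs_prod matrix_poly_funs_sum matrix_poly_funs.mult
        matrix_poly_funs.const matrix_poly_funs.entry)
  then have "zariski_closed {M. p M = 0}"
    unfolding zariski_closed_def by (intro exI[of _ "{p}"]) auto
  moreover have "G \<subseteq> {M. p M = 0}"
    using none S(1) unfolding p_def by (auto simp: prod_zero_iff)
  ultimately have "zariski_closed hull G \<subseteq> {M. p M = 0}" by (intro hull_minimal)
  then have "carrier SLpm \<subseteq> {M. p M = 0}"
    using dense unfolding zariski_dense_in_def by blast
  then show False
    using trace_forms_common_nonzero_SLpm[OF S] S(1) by (auto simp: p_def prod_zero_iff)
qed

lemma matrix_inv_mult:
  assumes "invertible (M :: 'a::semiring_1 ^ 'n ^ 'm)"
  shows matrix_mult_inv_right: "M ** matrix_inv M = mat 1"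
    and matrix_mult_inv_left: "matrix_inv M ** M = mat 1"
  using someI_ex[OF assms[unfolded invertible_def]] unfolding matrix_inv_def by auto

text \<open>By cyclicity of the trace, the form of \<open>matrix_inv r ** B\<close> takes at
  \<open>d ** r\<close> the value that the form of \<open>B\<close> takes at \<open>d\<close>. So
  each element of \<open>G\<close> would be killed by one of these finitely many translated forms,
  all nonzero if \<open>B\<close> is.\<close>

lemma finite_cover_trace_forms:
  fixes B :: "'a::{alg_closed_field, field_char_0} ^ 'n ^ 'n"
  assumes dense: "zariski_dense_in G (carrier SLpm)"
    and "finite R" and R: "\<And>r. r \<in> R \<Longrightarrow> invertible r"
    and cover: "\<And>g. g \<in> G \<Longrightarrow> \<exists>d\<in>D. \<exists>r\<in>R. g = d ** r"
    and B: "\<And>d. d \<in> D \<Longrightarrow> trace (B ** d) = 0"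
  shows "B = 0"
proof (rule ccontr)
  assume "B \<noteq> 0"
  have inv: "r ** matrix_inv r = mat 1" if "r \<in> R" for r
    using R[OF that] by (rule matrix_mult_inv_right)
  let ?S = "(\<lambda>r. matrix_inv r ** B) ` R"
  have "matrix_inv r ** B \<noteq> 0" if "r \<in> R" for r
  proof
    assume "matrix_inv r ** B = 0"
    then have "r ** (matrix_inv r ** B) = 0" by (simp add: matrix_matrix_mult_def vec_eq_iff)
    then show False using \<open>B \<noteq> 0\<close> inv[OF that] by (simp add: matrix_mul_assoc)
  qed
  then have "0 \<notin> ?S" by force
  then obtain g where g: "g \<in> G" "\<And>r. r \<in> R \<Longrightarrow> trace (matrix_inv r ** B ** g) \<noteq> 0"
    using zariski_dense_trace_forms[OF dense, of ?S] \<open>finite R\<close> by auto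
  from cover[OF g(1)] obtain d r where dr: "d \<in> D" "r \<in> R" "g = d ** r" by blast
  have "trace (matrix_inv r ** B ** g) = trace (matrix_inv r ** (B ** d ** r))"
    by (simp add: dr matrix_mul_assoc)
  also have "\<dots> = trace (B ** d ** r ** matrix_inv r)"
    by (rule trace_mul_sym)
  also have "\<dots> = trace (B ** d)"
    using inv[OF dr(2)] by (simp flip: matrix_mul_assoc)
  finally show False using g(2)[OF dr(2)] B[OF dr(1)] by simp
qed

text \<open>Every linear functional on matrices is a trace form, so a set with trivial annihilator
  under the trace pairing spans.\<close>

lemma trace_dual_span:
  fixes D :: "('a::field ^ 'n ^ 'n) set" and M :: "'a ^ 'n ^ 'n"
  assumes D: "\<And>B. (\<And>d. d \<in> D \<Longrightarrow> trace (B ** d) = 0) \<Longrightarrow> B = 0"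
  obtains T c where "finite T" "T \<subseteq> D" "\<And>i j. M $ i $ j = (\<Sum>d\<in>T. c d * d $ i $ j)"
proof -
  \<comment> \<open>Flattening to vectors indexed by pairs makes the theory of
    \<open>vec.span\<close> applicable to matrices.\<close>
  define fl :: "'a ^ 'n ^ 'n \<Rightarrow> 'a ^ ('n \<times> 'n)" where "fl M = (\<chi> p. M $ fst p $ snd p)" for M
  have inj: "inj fl" by (auto simp: inj_def fl_def vec_eq_iff)
  have all: "x \<in> vec.span (fl ` D)" for x
  proof (rule ccontr)
    assume x: "x \<notin> vec.span (fl ` D)"
    obtain E where E: "E \<subseteq> fl ` D" "vec.independent E" "fl ` D \<subseteq> vec.span E"
      by (rule vec.maximal_independent_subset)
    have spE: "vec.span E = vec.span (fl ` D)"
      using E by (metis vec.span_eq vec.span_superset subset_trans)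
    then have ind: "vec.independent (insert x E)" using x E(2) by (intro vec.independent_insertI) auto
    define E' where "E' = vec.extend_basis (insert x E)"
    have E': "vec.independent E'" "vec.span E' = UNIV" "insert x E \<subseteq> E'"
      unfolding E'_def using ind
      by (auto simp: vec.independent_extend_basis vec.span_extend_basis dest: vec.extend_basis_superset)
    \<comment> \<open>The coordinate along \<open>x\<close> in a basis extending \<open>E\<close>
      and \<open>x\<close>: a functional that is 1 at \<open>x\<close> and vanishes on the span of
      \<open>E\<close>.\<close>
    define g where "g v = vec.representation E' v x" for v
    have g_sum: "g (\<Sum>i\<in>I. c i *s w i) = (\<Sum>i\<in>I. c i * g (w i))" for I :: "'i set" and c w
      unfolding g_def by (simp add: vec.representation_sum[OF E'(1)] vec.representation_scale[OF E'(1)] E'(2))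
    have gx: "g x = 1" using E' unfolding g_def by (subst vec.representation_basis[OF E'(1)]) auto
    have gE: "g e = 0" if "e \<in> E" for e
      using that E' x spE vec.span_base[OF that] unfolding g_def
      by (subst vec.representation_basis[OF E'(1)]) auto
    \<comment> \<open>The indices are swapped because \<open>trace (B ** M)\<close> pairs
      \<open>B $ i $ k\<close> with \<open>M $ k $ i\<close>.\<close>
    define B :: "'a ^ 'n ^ 'n" where "B = (\<chi> i k. g (axis (k, i) 1))"
    have gB: "g (fl M) = trace (B ** M)" for M
    proof -
      have "g (fl M) = g (\<Sum>p\<in>UNIV. fl M $ p *s axis p 1)" by (simp add: basis_expansion)
      also have "\<dots> = (\<Sum>p\<in>UNIV. fl M $ p * g (axis p 1))" by (rule g_sum)
      also have "\<dots> = (\<Sum>(k, i)\<in>UNIV \<times> UNIV. M $ k $ i * g (axis (k, i) 1))"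
        by (auto intro!: sum.cong simp: fl_def)
      also have "\<dots> = (\<Sum>k\<in>UNIV. \<Sum>i\<in>UNIV. M $ k $ i * g (axis (k, i) 1))"
        by (rule sum.cartesian_product[symmetric])
      also have "\<dots> = (\<Sum>i\<in>UNIV. \<Sum>k\<in>UNIV. B $ i $ k * M $ k $ i)"
        by (subst sum.swap) (simp add: B_def mult.commute)
      finally show ?thesis by (simp add: trace_mult_expand)
    qed
    have "trace (B ** d) = 0" if "d \<in> D" for d
    proof -
      have "fl d \<in> vec.span E" using that E(3) by blast
      then obtain t r where "t \<subseteq> E" "fl d = (\<Sum>a\<in>t. r a *s a)" unfolding vec.span_explicit by blast
      then have "g (fl d) = (\<Sum>a\<in>t. r a * g a)" by (simp add: g_sum)
      also have "\<dots> = 0" using gE \<open>t \<subseteq> E\<close> by (intro sum.neutral) auto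
      finally show ?thesis by (simp add: gB)
    qed
    then have "B = 0" by (rule D)
    moreover obtain N where "x = fl N"
    proof
      show "x = fl (\<chi> i j. x $ (i, j))" by (simp add: fl_def vec_eq_iff)
    qed
    ultimately have "g x = 0" by (simp add: gB trace_def)
    then show False using gx by simp
  qed
  obtain t r where t: "finite t" "t \<subseteq> fl ` D" "fl M = (\<Sum>a\<in>t. r a *s a)"
    using all[of "fl M"] unfolding vec.span_explicit by blast
  obtain T where T: "T \<subseteq> D" "finite T" "t = fl ` T" using finite_subset_image[OF t(1,2)] by blast
  have "M $ i $ j = (\<Sum>d\<in>T. r (fl d) * d $ i $ j)" for i j
  proof -
    have "M $ i $ j = fl M $ (i, j)" by (simp add: fl_def)
    also have "\<dots> = (\<Sum>d\<in>T. r (fl d) * fl d $ (i, j))"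
      unfolding t(3) T(3) using inj
      by (subst sum.reindex) (auto intro: inj_on_subset simp: sum_component)
    finally show ?thesis by (simp add: fl_def)
  qed
  then show ?thesis by (rule that[OF T(2,1)])
qed

section \<open>Descent to the fraction field\<close>

definition mat_over :: "'a set \<Rightarrow> ('a ^ 'n ^ 'm) set" where
  "mat_over K = {M. \<forall>i j. M $ i $ j \<in> K}"

lemma mat_overI: "(\<And>i j. M $ i $ j \<in> K) \<Longrightarrow> M \<in> mat_over K"
  and mat_overD: "M \<in> mat_over K \<Longrightarrow> M $ i $ j \<in> K"
  by (auto simp: mat_over_def)

lemma mat_over_mult:
  "subfield_set K \<Longrightarrow> M \<in> mat_over K \<Longrightarrow> N \<in> mat_over K \<Longrightarrow> M ** N \<in> mat_over K"
  by (auto simp: mat_over_def matrix_matrix_mult_def intro!: subfield_set_sum subfield_set_mult)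

lemma mat_over_one: "subfield_set K \<Longrightarrow> mat 1 \<in> mat_over K"
  by (auto simp: mat_over_def mat_def intro: subfield_set_0 subfield_set_1)

lemma mat_over_det: "subfield_set K \<Longrightarrow> M \<in> mat_over K \<Longrightarrow> det M \<in> K"
  for M :: "'a::field ^ 'b ^ 'b"
proof -
  assume K: "subfield_set K" and M: "M \<in> mat_over K"
  have "of_int (sign p) \<in> K" for p :: "'b \<Rightarrow> 'b"
    using subfield_set_1[OF K] subfield_set_uminus[OF K] by (simp add: sign_def)
  then show "det M \<in> K"
    unfolding det_def
    by (intro subfield_set_sum[OF K] subfield_set_mult[OF K] subfield_set_prod[OF K] mat_overD[OF M])
qed

text \<open>Since the entries of \<open>M\<close> pass through \<open>\<pi>\<close>, projecting
  \<open>N\<close> entrywise gives another right inverse, now with entries in \<open>K\<close>.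
  Uniqueness of the inverse identifies it with \<open>N\<close>.\<close>

lemma mat_over_right_inverse:
  fixes M N :: "'a::field ^ 'n ^ 'n"
  assumes K: "subfield_set K" and M: "M \<in> mat_over K" and MN: "M ** N = mat 1"
  shows "N \<in> mat_over K"
proof -
  obtain \<pi> where \<pi>: "\<And>x. \<pi> x \<in> K" "\<And>k. k \<in> K \<Longrightarrow> \<pi> k = k"
    "\<And>x y. \<pi> (x + y) = \<pi> x + \<pi> y" "\<And>k x. k \<in> K \<Longrightarrow> \<pi> (k * x) = k * \<pi> x"
    using subfield_set_projection[OF K] by metis
  have \<pi>_sum: "\<pi> (sum f I) = (\<Sum>i\<in>I. \<pi> (f i))" for f and I :: "'n set"
    by (induction I rule: infinite_finite_induct) (auto simp: \<pi>(2)[OF subfield_set_0[OF K]] \<pi>(3))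
  let ?N = "\<chi> i j. \<pi> (N $ i $ j)"
  have "(M ** ?N) $ i $ j = (mat 1 :: 'a ^ 'n ^ 'n) $ i $ j" for i j
  proof -
    have "(M ** ?N) $ i $ j = (\<Sum>k\<in>UNIV. \<pi> (M $ i $ k * N $ k $ j))"
      by (simp add: matrix_matrix_mult_def \<pi>(4)[OF mat_overD[OF M]])
    also have "\<dots> = \<pi> ((M ** N) $ i $ j)" by (simp add: \<pi>_sum matrix_matrix_mult_def)
    also have "\<dots> = (mat 1 :: 'a ^ 'n ^ 'n) $ i $ j"
      unfolding MN by (rule \<pi>(2)[OF mat_overD[OF mat_over_one[OF K]]])
    finally show ?thesis .
  qed
  then have "M ** ?N = mat 1" by (simp add: vec_eq_iff)
  moreover have "N ** M = mat 1" using MN by (rule matrix_left_right_inverse1)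
  ultimately have "?N = N" by (metis matrix_mul_assoc matrix_mul_lid matrix_mul_rid)
  then have "N $ i $ j = \<pi> (N $ i $ j)" for i j by (metis vec_lambda_beta)
  then show ?thesis by (metis mat_overI \<pi>(1))
qed

text \<open>An ambient basis chosen inside the lattice is a basis over the fraction field of the space
  spanned by the lattice: a coordinate followed by the projection to \<open>K\<close> is linear on the lattice,
  hence extends linearly, hence agrees with the coordinate.\<close>

lemma lattice_over_frame:
  fixes L :: "('a::field ^ 'n) set"
  assumes K: "subfield_set K" and "A \<subseteq> K" and L: "lattice_over A L"
  obtains P Q :: "'a ^ 'n ^ 'n" where "P ** Q = mat 1" "Q ** P = mat 1" "\<And>j. column j P \<in> L"
    "\<And>v i. v \<in> L \<Longrightarrow> (Q *v v) $ i \<in> K"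
proof -
  obtain \<pi> where \<pi>: "\<And>x. \<pi> x \<in> K" "\<And>k. k \<in> K \<Longrightarrow> \<pi> k = k"
    "\<And>x y. \<pi> (x + y) = \<pi> x + \<pi> y" "\<And>k x. k \<in> K \<Longrightarrow> \<pi> (k * x) = k * \<pi> x"
    using subfield_set_projection[OF K] by metis
  obtain E where E: "E \<subseteq> L" "vec.independent E" "L \<subseteq> vec.span E"
    by (rule vec.maximal_independent_subset)
  have "vec.span L \<subseteq> vec.span E" using E(3) vec.span_minimal vec.subspace_span by blast
  then have sp: "vec.span E = UNIV" using lattice_over_span[OF L] by blast
  have "finite E" by (rule vec.finiteI_independent[OF E(2)])
  have "card E = vec.dim (UNIV :: ('a ^ 'n) set)"
    by (rule vec.basis_card_eq_dim) (use sp E in auto)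
  then have "card E = CARD('n)" by (simp only: vec_dim_card)
  then obtain f where f: "bij_betw f (UNIV :: 'n set) E"
    using \<open>finite E\<close> by (metis finite_same_card_bij finite)
  define P :: "'a ^ 'n ^ 'n" where "P = (\<chi> i j. f j $ i)"
  have col: "column j P = f j" for j by (simp add: P_def column_def vec_eq_iff)
  have "columns P = E" using f unfolding columns_def bij_betw_def by (auto simp: col)
  then obtain Q where PQ: "P ** Q = mat 1"
    using sp matrix_right_invertible_span_columns[of P] by auto
  then have QP: "Q ** P = mat 1" by (rule matrix_left_right_inverse1)
  have PL: "column j P \<in> L" for j using f E(1) unfolding col bij_betw_def by blast
  show ?thesis
  proof
    show "P ** Q = mat 1" "Q ** P = mat 1" by fact+
    show "column j P \<in> L" for j by (rule PL)
    fix v i assume v: "v \<in> L"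
    define \<phi> where "\<phi> w = \<pi> ((Q *v w) $ i)" for w
    have "\<phi> v = (\<Sum>j\<in>UNIV. (Q *v v) $ j * \<phi> (column j P))"
    proof (rule lattice_over_functional[OF L])
      show "\<phi> (x + y) = \<phi> x + \<phi> y" for x y
        by (simp add: \<phi>_def matrix_vector_right_distrib \<pi>(3))
      show "\<phi> (a *s x) = a * \<phi> x" if "a \<in> A" for a x
        using that \<open>A \<subseteq> K\<close> by (auto simp: \<phi>_def vector_scalar_commute \<pi>(4))
      show "column j P \<in> L" for j by (rule PL)
      show "v \<in> L" by (rule v)
      have "v = P *v (Q *v v)" by (simp add: matrix_vector_mul_assoc PQ)
      then show "v = (\<Sum>j\<in>UNIV. (Q *v v) $ j *s column j P)"
        by (metis matrix_mult_sum)
    qed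
    moreover have "\<phi> (column j P) = (if i = j then 1 else 0)" for j
    proof -
      have "(Q *v column j P) $ i = (Q ** P) $ i $ j"
        by (simp add: matrix_vector_mult_def matrix_matrix_mult_def column_def)
      also have "\<dots> = (if i = j then 1 else 0)" by (simp add: QP mat_def)
      finally show ?thesis
        using \<pi>(2)[OF subfield_set_0[OF K]] \<pi>(2)[OF subfield_set_1[OF K]] by (simp add: \<phi>_def)
    qed
    ultimately have "\<phi> v = (Q *v v) $ i" by (simp add: if_distrib cong: if_cong)
    then show "(Q *v v) $ i \<in> K" using \<pi>(1) by (metis \<phi>_def)
  qed
qed

text \<open>The Skolem-Noether theorem in the only case needed: the entries \<open>s $ a $ i * t $ j $ b\<close>
  are those of the conjugate of the matrix unit at \<open>(i, j)\<close>.\<close>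

lemma conjugation_entries_in_subfield:
  fixes s t :: "'a::field ^ 'n ^ 'n"
  assumes K: "subfield_set K"
    and D: "\<And>B. (\<And>d. d \<in> D \<Longrightarrow> trace (B ** d) = 0) \<Longrightarrow> B = 0"
    and DK: "\<And>d. d \<in> D \<Longrightarrow> d \<in> mat_over K" "\<And>d. d \<in> D \<Longrightarrow> s ** d ** t \<in> mat_over K"
  shows "s $ a $ i * t $ j $ b \<in> K"
proof -
  obtain \<pi> where \<pi>: "\<And>x. \<pi> x \<in> K" "\<And>k. k \<in> K \<Longrightarrow> \<pi> k = k"
    "\<And>x y. \<pi> (x + y) = \<pi> x + \<pi> y" "\<And>k x. k \<in> K \<Longrightarrow> \<pi> (k * x) = k * \<pi> x"
    using subfield_set_projection[OF K] by metis
  have \<pi>_sum: "\<pi> (sum f I) = (\<Sum>i\<in>I. \<pi> (f i))" for f and I :: "('a ^ 'n ^ 'n) set"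
    by (induction I rule: infinite_finite_induct) (auto simp: \<pi>(2)[OF subfield_set_0[OF K]] \<pi>(3))
  define U :: "'a ^ 'n ^ 'n" where "U = (\<chi> x y. if x = i \<and> y = j then 1 else 0)"
  obtain T c where "finite T" and T: "T \<subseteq> D" and c: "\<And>x y. U $ x $ y = (\<Sum>d\<in>T. c d * d $ x $ y)"
    by (rule trace_dual_span[of D U], rule D, simp) (rule that)
  \<comment> \<open>The entries of \<open>U\<close> and of each \<open>d\<close> lie in
    \<open>K\<close>, so applying \<open>\<pi>\<close> to the identity replaces the coefficients by
    elements of \<open>K\<close>.\<close>
  have U: "U $ x $ y = (\<Sum>d\<in>T. \<pi> (c d) * d $ x $ y)" for x y
  proof -
    have "U $ x $ y = \<pi> (U $ x $ y)"
      using \<pi>(2)[OF subfield_set_0[OF K]] \<pi>(2)[OF subfield_set_1[OF K]] by (simp add: U_def)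
    also have "\<dots> = (\<Sum>d\<in>T. \<pi> (d $ x $ y * c d))" by (simp add: c \<pi>_sum mult.commute)
    also have "\<dots> = (\<Sum>d\<in>T. d $ x $ y * \<pi> (c d))"
      using T DK(1) by (intro sum.cong refl \<pi>(4)) (auto intro: mat_overD)
    finally show ?thesis by (simp add: mult.commute)
  qed
  have conj: "(s ** M ** t) $ a $ b = (\<Sum>y\<in>UNIV. \<Sum>x\<in>UNIV. s $ a $ x * M $ x $ y * t $ y $ b)" for M
    by (simp add: matrix_matrix_mult_def sum_distrib_right)
  have "s $ a $ i * t $ j $ b = (s ** U ** t) $ a $ b"
  proof -
    have "(s ** U ** t) $ a $ b =
        (\<Sum>y\<in>UNIV. \<Sum>x\<in>UNIV. if x = i then (if y = j then s $ a $ i * t $ j $ b else 0) else 0)"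
      unfolding conj by (intro sum.cong refl) (simp add: U_def)
    then show ?thesis by simp
  qed
  also have "\<dots> = (\<Sum>y\<in>UNIV. \<Sum>x\<in>UNIV. \<Sum>d\<in>T. \<pi> (c d) * (s $ a $ x * d $ x $ y * t $ y $ b))"
    unfolding conj U by (simp add: sum_distrib_left sum_distrib_right mult_ac)
  also have "\<dots> = (\<Sum>y\<in>UNIV. \<Sum>d\<in>T. \<Sum>x\<in>UNIV. \<pi> (c d) * (s $ a $ x * d $ x $ y * t $ y $ b))"
    by (intro sum.cong refl sum.swap)
  also have "\<dots> = (\<Sum>d\<in>T. \<Sum>y\<in>UNIV. \<Sum>x\<in>UNIV. \<pi> (c d) * (s $ a $ x * d $ x $ y * t $ y $ b))"
    by (rule sum.swap)
  also have "\<dots> = (\<Sum>d\<in>T. \<pi> (c d) * (s ** d ** t) $ a $ b)"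
    unfolding conj by (simp add: sum_distrib_left)
  also have "\<dots> \<in> K"
    using T DK(2) by (intro subfield_set_sum[OF K] subfield_set_mult[OF K] \<pi>(1)) (auto intro: mat_overD)
  finally show ?thesis .
qed

section \<open>Matrix groups and the scalar attached to a generator\<close>

lemma matrix_subgroupD:
  fixes S :: "('a::field ^ 'n ^ 'n) set"
  assumes "group G" "monoid.mult G = (\<lambda>M N. M ** N)" "one G = mat 1" and S: "subgroup S G"
  shows "mat 1 \<in> S" and "M \<in> S \<Longrightarrow> N \<in> S \<Longrightarrow> M ** N \<in> S"
    and "M \<in> S \<Longrightarrow> \<exists>N\<in>S. M ** N = mat 1 \<and> N ** M = mat 1"
proof -
  interpret G: group G by fact
  interpret S: subgroup S G by fact
  show "mat 1 \<in> S" using S.one_closed assms(3) by simp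
  show "M \<in> S \<Longrightarrow> N \<in> S \<Longrightarrow> M ** N \<in> S" using S.m_closed[of M N] assms(2) by simp
  assume M: "M \<in> S"
  then have "M \<in> carrier G" by (rule S.mem_carrier)
  from G.r_inv[OF this] G.l_inv[OF this] S.m_inv_closed[OF M]
  show "\<exists>N\<in>S. M ** N = mat 1 \<and> N ** M = mat 1" using assms(2,3) by auto
qed

text \<open>It suffices that \<open>\<tau>\<close> lies in \<open>K\<close>. Conjugation preserves
  trace and determinant. In the first case, dividing the trace of the scaled matrix by
  \<open>trace \<sigma>\<close> gives \<open>\<tau>\<close>; in the second, \<open>\<tau>\<close>
  has two powers in \<open>K\<close> with coprime exponents, one from the order and one from the
  determinant.\<close>

lemma scalar_multiple_in_subfield:
  fixes \<sigma> P Q :: "'a::field ^ 'n ^ 'n"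
  assumes K: "subfield_set K" and PQ: "P ** Q = mat 1" "Q ** P = mat 1"
    and \<sigma>: "\<sigma> \<in> carrier SLpm"
    and \<tau>: "\<tau> \<noteq> 0" "\<And>a i. \<tau> * (Q ** \<sigma> ** P) $ a $ i \<in> K"
    and cond: "trace \<sigma> \<noteq> 0 \<and> trace \<sigma> \<in> K \<or>
      group.ord SLpm \<sigma> \<noteq> 0 \<and> coprime (group.ord SLpm \<sigma>) CARD('n)"
  shows "Q ** \<sigma> ** P \<in> mat_over K"
proof -
  interpret SL: group "SLpm :: ('a ^ 'n ^ 'n) monoid" by (rule group_SLpm)
  let ?s = "Q ** \<sigma> ** P"
  have "\<tau> \<in> K"
    using cond
  proof
    assume tr: "trace \<sigma> \<noteq> 0 \<and> trace \<sigma> \<in> K"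
    have "trace ?s = trace (P ** (Q ** \<sigma>))" by (rule trace_mul_sym)
    also have "\<dots> = trace \<sigma>" by (simp add: matrix_mul_assoc PQ)
    finally have "\<tau> * trace \<sigma> = \<tau> * trace ?s" by simp
    also have "\<dots> = (\<Sum>a\<in>UNIV. \<tau> * ?s $ a $ a)"
      unfolding trace_def by (rule sum_distrib_left)
    also have "\<dots> \<in> K" by (intro subfield_set_sum[OF K] \<tau>)
    finally have "\<tau> * trace \<sigma> / trace \<sigma> \<in> K"
      by (rule subfield_set_divide[OF K _ conjunct2[OF tr]])
    then show ?thesis using tr by simp
  next
    assume ord: "group.ord SLpm \<sigma> \<noteq> 0 \<and> coprime (group.ord SLpm \<sigma>) CARD('n)"
    have pow: "\<tau> ^ k * (Q ** (\<sigma> [^]\<^bsub>SLpm\<^esub> k) ** P) $ a $ b \<in> K" for k :: nat and a b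
    proof (induction k arbitrary: a b)
      case 0
      have "Q ** \<one>\<^bsub>SLpm\<^esub> ** P = mat 1" by (simp add: SLpm_def PQ)
      then show ?case using mat_overD[OF mat_over_one[OF K]] by simp
    next
      case (Suc k)
      \<comment> \<open>Inserting \<open>P ** Q\<close> splits the conjugated power, and one factor
        \<open>\<tau>\<close> goes to each factor \<open>?s\<close>.\<close>
      have "Q ** (\<sigma> [^]\<^bsub>SLpm\<^esub> Suc k) ** P = Q ** ((\<sigma> [^]\<^bsub>SLpm\<^esub> k) ** (P ** Q) ** \<sigma>) ** P"
        by (simp add: PQ) (simp add: SLpm_def)
      also have "\<dots> = (Q ** (\<sigma> [^]\<^bsub>SLpm\<^esub> k) ** P) ** ?s" by (simp add: matrix_mul_assoc)
      finally have "\<tau> ^ Suc k * (Q ** (\<sigma> [^]\<^bsub>SLpm\<^esub> Suc k) ** P) $ a $ b =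
          (\<Sum>x\<in>UNIV. (\<tau> ^ k * (Q ** (\<sigma> [^]\<^bsub>SLpm\<^esub> k) ** P) $ a $ x) * (\<tau> * ?s $ x $ b))"
        by (simp add: matrix_matrix_mult_def[of "Q ** (\<sigma> [^]\<^bsub>SLpm\<^esub> k) ** P"] sum_distrib_left mult_ac)
      also have "\<dots> \<in> K" by (intro subfield_set_sum[OF K] subfield_set_mult[OF K] Suc \<tau>)
      finally show ?case .
    qed
    have "\<sigma> [^]\<^bsub>SLpm\<^esub> group.ord SLpm \<sigma> = mat 1"
      using SL.pow_ord_eq_1[OF \<sigma>] by (simp add: SLpm_def)
    then have "Q ** (\<sigma> [^]\<^bsub>SLpm\<^esub> group.ord SLpm \<sigma>) ** P = mat 1" by (simp add: PQ)
    then have "\<tau> ^ group.ord SLpm \<sigma> * (mat 1 :: 'a ^ 'n ^ 'n) $ a $ a \<in> K" for a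
      using pow[of "group.ord SLpm \<sigma>" a a] by simp
    then have "\<tau> ^ group.ord SLpm \<sigma> \<in> K" by (simp add: mat_def)
    moreover have "\<tau> ^ CARD('n) \<in> K"
    proof -
      \<comment> \<open>Scaling all rows brings out \<open>\<tau>\<close> once per row; the
        remaining determinant is a sign, which \<open>K\<close> absorbs.\<close>
      have "det (\<chi> a. \<tau> *s ?s $ a) = \<tau> ^ CARD('n) * det ?s"
        using det_rows_mul[of "\<lambda>_. \<tau>" "\<lambda>a. ?s $ a"] by simp
      moreover have "det (\<chi> a. \<tau> *s ?s $ a) \<in> K"
        by (intro mat_over_det[OF K] mat_overI) (simp add: \<tau>)
      moreover have "det Q * det P = 1" using PQ by (metis det_mul det_I)
      then have "det ?s = det \<sigma>" by (simp add: det_mul mult.left_commute mult.commute)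
      ultimately have "\<tau> ^ CARD('n) * det \<sigma> \<in> K" by simp
      moreover have "det \<sigma> = 1 \<or> det \<sigma> = - 1" using \<sigma> by (simp add: SLpm_def)
      ultimately show ?thesis
        using subfield_set_uminus[OF K, of "\<tau> ^ CARD('n) * det \<sigma>"] by (elim disjE) simp_all
    qed
    ultimately show ?thesis
      using ord subfield_set_coprime_powers[OF K, of \<tau> "group.ord SLpm \<sigma>" "CARD('n)"] by simp
  qed
  then have "\<tau> * ?s $ a $ i / \<tau> \<in> K" for a i
    by (rule subfield_set_divide[OF K \<tau>(2)])
  then show ?thesis using \<tau>(1) by (intro mat_overI) simp
qed

section \<open>Passing to the larger group\<close>

text \<open>Combined with minimality of the hull, this reduces the claim that a matrix maps a
  generated module into \<open>L\<close> to its generators.\<close>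

lemma submodule_over_vimage_matrix:
  fixes M :: "'a::field ^ 'n ^ 'm"
  shows "submodule_over A L \<Longrightarrow> submodule_over A {v. M *v v \<in> L}"
  by (simp add: submodule_over_def matrix_vector_right_distrib vector_scalar_commute)

lemma submodule_over_vimage_scale:
  "submodule_over A L \<Longrightarrow> submodule_over A {v. d *s v \<in> L}"
  by (simp add: submodule_over_def vector_add_ldistrib vector_smult_assoc mult.commute)
    (metis vector_smult_assoc mult.commute)

lemma submodule_over_hull_minimal:
  "S \<subseteq> L \<Longrightarrow> submodule_over A L \<Longrightarrow> submodule_over A hull S \<subseteq> L"
  by (rule hull_minimal)

text \<open>Denominators multiply: if \<open>d\<close> clears the earlier terms and the new
  coefficient is \<open>a / b\<close>, then \<open>b * d\<close> clears the whole sum.\<close>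

lemma fraction_combination_denominator:
  fixes A :: "'a::field set"
  assumes ring: "subring A (ring_of_type_algebra :: 'a ring)" and L: "submodule_over A L"
    and "finite J" "\<And>j. j \<in> J \<Longrightarrow> k j \<in> fraction_field_in A" "\<And>j. j \<in> J \<Longrightarrow> e j \<in> L"
  shows "\<exists>d\<in>A. d \<noteq> 0 \<and> d *s (\<Sum>j\<in>J. k j *s e j) \<in> L"
  using assms(3-)
proof (induction J rule: finite_induct)
  case empty
  then show ?case
    using subring_ring_of_type_algebraD(2)[OF ring] submodule_overD(1)[OF L] by (intro bexI[of _ 1]) auto
next
  case (insert j J)
  note A = subring_ring_of_type_algebraD[OF ring] and L = submodule_overD[OF L]
  obtain d where d: "d \<in> A" "d \<noteq> 0" "d *s (\<Sum>j\<in>J. k j *s e j) \<in> L"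
    using insert.IH insert.prems by auto
  obtain a b where ab: "k j = a / b" "a \<in> A" "b \<in> A" "b \<noteq> 0"
    using insert.prems(1)[of j] unfolding fraction_field_in_def by auto
  have "(b * d) *s (\<Sum>j\<in>insert j J. k j *s e j) =
      (d * a) *s e j + b *s (d *s (\<Sum>j\<in>J. k j *s e j))"
    using insert(1,2) ab by (simp add: vector_add_ldistrib vector_smult_assoc)
  also have "\<dots> \<in> L"
    by (intro L(2) L(3) A(4) d ab insert.prems(2)) simp
  finally show ?case using d ab A(4) by (intro bexI[of _ "b * d"]) auto
qed

lemma common_denominator:
  fixes A :: "'a::field set"
  assumes ring: "subring A (ring_of_type_algebra :: 'a ring)" and L: "submodule_over A L"
    and "finite T" "\<And>x. x \<in> T \<Longrightarrow> \<exists>d\<in>A. d \<noteq> 0 \<and> d *s x \<in> L"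
  shows "\<exists>d\<in>A. d \<noteq> 0 \<and> (\<forall>x\<in>T. d *s x \<in> L)"
  using assms(3-)
proof (induction T rule: finite_induct)
  case empty
  then show ?case using subring_ring_of_type_algebraD(2)[OF ring] by (intro bexI[of _ 1]) auto
next
  case (insert x T)
  obtain d where d: "d \<in> A" "d \<noteq> 0" "\<And>x. x \<in> T \<Longrightarrow> d *s x \<in> L"
    using insert.IH insert.prems by auto
  obtain b where b: "b \<in> A" "b \<noteq> 0" "b *s x \<in> L" using insert.prems[of x] by auto
  have "(b * d) *s x \<in> L"
    using submodule_overD(3)[OF L d(1) b(3)] by (simp add: vector_smult_assoc mult.commute)
  moreover have "(b * d) *s y \<in> L" if "y \<in> T" for y
    using submodule_overD(3)[OF L b(1) d(3)[OF that]] by (simp add: vector_smult_assoc)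
  ultimately show ?case
    using d b subring_ring_of_type_algebraD(4)[OF ring] by (intro bexI[of _ "b * d"]) auto
qed

text \<open>Two elements of \<open>\<Gamma>\<close> in the same right cosets of \<open>\<Delta>\<close>, also after left multiplication by \<open>s\<close>,
  differ by an element of \<open>\<Delta>\<close> whose conjugate by \<open>s\<close> lies in \<open>\<Delta>\<close>.\<close>

lemma finite_cover_conjugate_intersection:
  fixes \<Gamma> \<Delta> :: "('a::field ^ 'n ^ 'n) set"
  assumes fin: "finite ((\<lambda>g. (\<lambda>d. d ** g) ` \<Delta>) ` \<Gamma>)"
    and \<Gamma>: "\<forall>g\<in>\<Gamma>. \<forall>h\<in>\<Gamma>. g ** h \<in> \<Gamma>" "\<forall>g\<in>\<Gamma>. invertible g"
    and "mat 1 \<in> \<Delta>" and s: "s \<in> \<Gamma>" "s ** t = mat 1"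
  shows "\<exists>R. finite R \<and> R \<subseteq> \<Gamma> \<and>
    (\<forall>g\<in>\<Gamma>. \<exists>d\<in>{d \<in> \<Delta>. s ** d ** t \<in> \<Delta>}. \<exists>r\<in>R. g = d ** r)"
proof -
  define C where "C g = (\<lambda>d. d ** g) ` \<Delta>" for g :: "'a ^ 'n ^ 'n"
  define F where "F g = (C g, C (s ** g))" for g
  have "F ` \<Gamma> \<subseteq> C ` \<Gamma> \<times> C ` \<Gamma>" using \<Gamma>(1) s(1) by (auto simp: F_def)
  moreover have "finite (C ` \<Gamma>)" using fin by (simp add: C_def)
  ultimately have "finite (F ` \<Gamma>)" by (meson finite_SigmaI finite_subset)
  \<comment> \<open>Only finitely many pairs of cosets occur; \<open>R\<close> supplies a
    representative for each.\<close>
  then obtain R where R: "R \<subseteq> \<Gamma>" "finite R" "F ` \<Gamma> = F ` R"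
    using finite_subset_image[OF _ order_refl] by metis
  have self: "g \<in> C g" for g using \<open>mat 1 \<in> \<Delta>\<close> unfolding C_def by (intro image_eqI[of _ _ "mat 1"]) auto
  show ?thesis
  proof (intro exI[of _ R] conjI ballI)
    fix g assume "g \<in> \<Gamma>"
    then have "F g \<in> F ` R" unfolding R(3)[symmetric] by (rule imageI)
    then obtain r where r: "r \<in> R" "F g = F r" by (rule imageE)
    then have C: "C g = C r" "C (s ** g) = C (s ** r)" by (auto simp: F_def)
    obtain d where d: "d \<in> \<Delta>" "g = d ** r" using self[of g] unfolding C(1) by (auto simp: C_def)
    obtain d' where d': "d' \<in> \<Delta>" "s ** g = d' ** (s ** r)"
      using self[of "s ** g"] unfolding C(2) by (auto simp: C_def)
    obtain r' where r': "r ** r' = mat 1"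
      using \<Gamma>(2) r(1) R(1) unfolding invertible_def by blast
    have "s ** d ** (r ** r') ** t = s ** g ** r' ** t" by (simp add: d(2) matrix_mul_assoc)
    also have "\<dots> = d' ** (s ** (r ** r') ** t)" by (simp add: d'(2) matrix_mul_assoc)
    finally have "s ** d ** t = d'" by (simp add: r' s(2))
    then show "\<exists>d\<in>{d \<in> \<Delta>. s ** d ** t \<in> \<Delta>}. \<exists>r\<in>R. g = d ** r"
      using d d'(1) r(1) by blast
  qed (use R in auto)
qed

text \<open>The module generated by the images of \<open>L\<close> is finitely generated since finitely many left
  cosets of \<open>\<Delta>\<close> cover \<open>\<Gamma>\<close>, and it is commensurable with \<open>L\<close>.\<close>

lemma lattice_over_orbit:
  fixes A :: "'a::field set" and \<Gamma> :: "('a ^ 'n ^ 'n) set"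
  assumes ring: "subring A (ring_of_type_algebra :: 'a ring)" and L: "lattice_over A L"
    and \<Delta>: "\<And>d v. d \<in> \<Delta> \<Longrightarrow> v \<in> L \<Longrightarrow> d *v v \<in> L"
    and \<Gamma>: "mat 1 \<in> \<Gamma>" "\<And>g h. g \<in> \<Gamma> \<Longrightarrow> h \<in> \<Gamma> \<Longrightarrow> g ** h \<in> \<Gamma>"
    and "finite R" "R \<subseteq> \<Gamma>" and cover: "\<And>g. g \<in> \<Gamma> \<Longrightarrow> \<exists>r\<in>R. \<exists>d\<in>\<Delta>. g = r ** d"
    and denom: "\<And>g v. g \<in> \<Gamma> \<Longrightarrow> v \<in> L \<Longrightarrow> \<exists>d\<in>A. d \<noteq> 0 \<and> d *s (g *v v) \<in> L"
  shows "definable_over A \<Gamma>"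
proof -
  obtain S where sub: "submodule_over A L" and S: "finite S" "L = submodule_over A hull S"
    using L unfolding lattice_over_def fin_gen_submodule_def by blast
  define L' where "L' = submodule_over A hull (\<Union>g\<in>\<Gamma>. (*v) g ` L)"
  define T where "T = (\<Union>r\<in>R. (*v) r ` S)"
  have sub': "submodule_over A L'" unfolding L'_def by (rule submodule_over_hull)
  have gen: "g *v v \<in> L'" if "g \<in> \<Gamma>" "v \<in> L" for g v
    unfolding L'_def by (rule hull_inc) (use that in blast)
  have "S \<subseteq> L" unfolding S(2) by (rule hull_subset)
  \<comment> \<open>Writing \<open>g = r ** d\<close>, invariance under \<open>d\<close> puts the
    image of \<open>L\<close> under \<open>g\<close> inside its image under \<open>r\<close>, which
    is generated by the image of \<open>S\<close>.\<close>
  have "L' = submodule_over A hull T"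
  proof (rule equalityI)
    let ?H = "submodule_over A hull T"
    have subH: "submodule_over A ?H" by (rule submodule_over_hull)
    show "L' \<subseteq> ?H"
      unfolding L'_def
    proof (rule submodule_over_hull_minimal[OF _ subH], intro UN_least image_subsetI)
      fix g v assume "g \<in> \<Gamma>" "v \<in> L"
      from cover[OF \<open>g \<in> \<Gamma>\<close>] obtain r d where rd: "r \<in> R" "d \<in> \<Delta>" "g = r ** d" by blast
      have "L \<subseteq> {v. r *v v \<in> ?H}"
        unfolding S(2)
      proof (rule submodule_over_hull_minimal[OF _ submodule_over_vimage_matrix[OF subH]], intro subsetI CollectI)
        fix x assume "x \<in> S"
        show "r *v x \<in> ?H" by (rule hull_inc) (use \<open>x \<in> S\<close> rd(1) T_def in blast)
      qed
      then have "r *v (d *v v) \<in> ?H" using \<Delta>[OF rd(2) \<open>v \<in> L\<close>] by blast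
      then show "g *v v \<in> ?H" by (simp add: rd(3) matrix_vector_mul_assoc)
    qed
    show "?H \<subseteq> L'"
    proof (rule submodule_over_hull_minimal[OF _ sub'], unfold T_def, intro UN_least image_subsetI)
      fix r x assume "r \<in> R" "x \<in> S"
      then show "r *v x \<in> L'" using \<open>S \<subseteq> L\<close> \<open>R \<subseteq> \<Gamma>\<close> by (intro gen) auto
    qed
  qed
  moreover have "finite T" unfolding T_def using \<open>finite R\<close> S(1) by blast
  ultimately have fg: "fin_gen_submodule A L'" unfolding fin_gen_submodule_def using sub' by blast
  \<comment> \<open>A common denominator for the finitely many generators scales all of
    \<open>L'\<close> into \<open>L\<close>, as commensurability requires.\<close>
  have "\<exists>d\<in>A. d \<noteq> 0 \<and> (\<forall>x\<in>T. d *s x \<in> L)"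
  proof (rule common_denominator[OF ring sub \<open>finite T\<close>])
    fix x assume "x \<in> T"
    then obtain r y where "r \<in> R" "y \<in> S" "x = r *v y" unfolding T_def by blast
    then have "r \<in> \<Gamma>" "y \<in> L" using \<open>S \<subseteq> L\<close> \<open>R \<subseteq> \<Gamma>\<close> by auto
    from denom[OF this] show "\<exists>d\<in>A. d \<noteq> 0 \<and> d *s x \<in> L" unfolding \<open>x = r *v y\<close> .
  qed
  then obtain d where d: "d \<in> A" "d \<noteq> 0" "\<And>x. x \<in> T \<Longrightarrow> d *s x \<in> L" by blast
  have "L' \<subseteq> {v. d *s v \<in> L}"
    unfolding \<open>L' = submodule_over A hull T\<close>
    by (rule submodule_over_hull_minimal[OF _ submodule_over_vimage_scale[OF sub]]) (use d(3) in auto)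
  moreover have "L \<subseteq> L'" using gen[OF \<Gamma>(1)] by auto
  ultimately have "lattice_over A L'"
    by (intro lattice_over_commensurable[OF L fg _ d(1,2)]) auto
  moreover have "g *v v \<in> L'" if "g \<in> \<Gamma>" "v \<in> L'" for g v
  proof -
    have "L' \<subseteq> {v. g *v v \<in> L'}"
      unfolding L'_def
    proof (rule submodule_over_hull_minimal[OF _ submodule_over_vimage_matrix[OF submodule_over_hull]], intro UN_least image_subsetI CollectI)
      fix h v assume "h \<in> \<Gamma>" "v \<in> L"
      then show "g *v (h *v v) \<in> submodule_over A hull (\<Union>g\<in>\<Gamma>. (*v) g ` L)"
        using gen[OF \<Gamma>(2)[OF \<open>g \<in> \<Gamma>\<close> \<open>h \<in> \<Gamma>\<close>]] by (simp add: matrix_vector_mul_assoc L'_def)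
    qed
    then show ?thesis using that(2) by blast
  qed
  ultimately show ?thesis unfolding definable_over_def by blast
qed

theorem theorem1p2:
  fixes n m :: nat
    and \<sigma> :: "nat \<Rightarrow> ('f::{alg_closed_field, field_char_0}) ^ 'd ^ 'd"
    and \<Gamma> \<Delta> :: "('f ^ 'd ^ 'd) set"
    and A :: "'f set"
  assumes "n \<ge> 2" and "CARD('d) = n + 1"
    and "subgroup \<Gamma> SLpm"
    and "zariski_dense_in \<Gamma> (carrier SLpm)"
    and "\<sigma> ` {1..m} \<subseteq> carrier SLpm"
    and "\<Gamma> = generate SLpm (\<sigma> ` {1..m})"
    and "subgroup \<Delta> (SLpm\<lparr>carrier := \<Gamma>\<rparr>)"
    and "finite (rcosets\<^bsub>SLpm\<lparr>carrier := \<Gamma>\<rparr>\<^esub> \<Delta>)"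
    and "subring A (ring_of_type_algebra :: 'f ring)"
    and "noetherian_ring (ring_on A)"
    and "integrally_closed A"
    and "\<forall>i \<in> {1..m}.
           (trace (\<sigma> i) \<noteq> 0 \<and> trace (\<sigma> i) \<in> fraction_field_in A) \<or>
           (group.ord SLpm (\<sigma> i) \<noteq> 0 \<and> coprime (group.ord SLpm (\<sigma> i)) (n + 1))"
  shows "definable_over A \<Gamma> \<longleftrightarrow> definable_over A \<Delta>"
proof
  have "\<Delta> \<subseteq> \<Gamma>" using subgroup.subset[OF assms(7)] by simp
  then show "definable_over A \<Gamma> \<Longrightarrow> definable_over A \<Delta>"
    unfolding definable_over_def by blast
  assume "definable_over A \<Delta>"
  then obtain L where L: "lattice_over A L" and "\<And>d. d \<in> \<Delta> \<Longrightarrow> (\<lambda>v. d *v v) ` L \<subseteq> L"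
    unfolding definable_over_def by blast
  then have \<Delta>L: "d *v v \<in> L" if "d \<in> \<Delta>" "v \<in> L" for d v using that by blast
  have sub: "submodule_over A L" using L unfolding lattice_over_def fin_gen_submodule_def by blast
  define K where "K = fraction_field_in A"
  have K: "subfield_set K" and AK: "A \<subseteq> K"
    using fraction_field_in_subfield_set[OF assms(9)] by (simp_all add: K_def)
  have gH: "group (SLpm\<lparr>carrier := \<Gamma>\<rparr>)" by (rule subgroup.subgroup_is_group[OF assms(3) group_SLpm])
  have "monoid.mult (SLpm :: ('f ^ 'd ^ 'd) monoid) = (\<lambda>M N. M ** N)" "one (SLpm :: ('f ^ 'd ^ 'd) monoid) = mat 1"
    by (simp_all add: SLpm_def)
  then have \<Gamma>: "mat 1 \<in> \<Gamma>" "\<And>g h. g \<in> \<Gamma> \<Longrightarrow> h \<in> \<Gamma> \<Longrightarrow> g ** h \<in> \<Gamma>"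
      "\<And>g. g \<in> \<Gamma> \<Longrightarrow> \<exists>h\<in>\<Gamma>. g ** h = mat 1 \<and> h ** g = mat 1"
    and \<Delta>: "mat 1 \<in> \<Delta>" "\<And>g h. g \<in> \<Delta> \<Longrightarrow> h \<in> \<Delta> \<Longrightarrow> g ** h \<in> \<Delta>"
      "\<And>g. g \<in> \<Delta> \<Longrightarrow> \<exists>h\<in>\<Delta>. g ** h = mat 1 \<and> h ** g = mat 1"
    using matrix_subgroupD[OF group_SLpm _ _ assms(3)] matrix_subgroupD[OF gH _ _ assms(7)] by simp_all
  have \<Gamma>inv: "invertible g" if "g \<in> \<Gamma>" for g using \<Gamma>(3)[OF that] unfolding invertible_def by blast
  have "rcosets\<^bsub>SLpm\<lparr>carrier := \<Gamma>\<rparr>\<^esub> \<Delta> = (\<lambda>g. (\<lambda>d. d ** g) ` \<Delta>) ` \<Gamma>"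
    by (auto simp: RCOSETS_def r_coset_def SLpm_def)
  then have fin: "finite ((\<lambda>g. (\<lambda>d. d ** g) ` \<Delta>) ` \<Gamma>)" using assms(8) by simp
  have "\<forall>g\<in>\<Gamma>. \<forall>h\<in>\<Gamma>. g ** h \<in> \<Gamma>" "\<forall>g\<in>\<Gamma>. invertible g" using \<Gamma>(2) \<Gamma>inv by simp_all
  note cover = finite_cover_conjugate_intersection[OF fin this \<Delta>(1)]
  obtain P Q :: "'f ^ 'd ^ 'd" where PQ: "P ** Q = mat 1" "Q ** P = mat 1"
    and PL: "\<And>j. column j P \<in> L" and QL: "\<And>v i. v \<in> L \<Longrightarrow> (Q *v v) $ i \<in> K"
    using lattice_over_frame[OF K AK L] by metis
  \<comment> \<open>Column \<open>j\<close> lists the coordinates of the image under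
    \<open>d\<close> of a frame vector, and this image stays in \<open>L\<close>.\<close>
  have \<Delta>K: "Q ** d ** P \<in> mat_over K" if "d \<in> \<Delta>" for d
  proof (rule mat_overI)
    fix i j
    have "(Q ** d ** P) $ i $ j = (Q *v (d *v column j P)) $ i"
      unfolding matrix_vector_mul_assoc by (simp add: matrix_vector_mult_def matrix_matrix_mult_def column_def)
    then show "(Q ** d ** P) $ i $ j \<in> K" using QL[OF \<Delta>L[OF that PL]] by metis
  qed
  have \<sigma>K: "Q ** \<sigma> i ** P \<in> mat_over K" if i: "i \<in> {1..m}" for i
  proof -
    have "\<sigma> i \<in> \<Gamma>" unfolding assms(6) using i by (intro generate.incl imageI)
    then obtain t where t: "\<sigma> i ** t = mat 1" "t ** \<sigma> i = mat 1" using \<Gamma>(3) by blast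
    let ?D = "{d \<in> \<Delta>. \<sigma> i ** d ** t \<in> \<Delta>}"
    obtain R where R: "finite R" "R \<subseteq> \<Gamma>" "\<And>g. g \<in> \<Gamma> \<Longrightarrow> \<exists>d\<in>?D. \<exists>r\<in>R. g = d ** r"
      using cover[OF \<open>\<sigma> i \<in> \<Gamma>\<close> t(1)] by blast
    \<comment> \<open>Undoing the change of basis by cyclicity turns the form of \<open>B\<close>
      into that of \<open>P ** B ** Q\<close> on \<open>?D\<close>, where the finite cover forces it
      to be zero.\<close>
    have D: "B = 0" if B: "\<And>d. d \<in> (\<lambda>d. Q ** d ** P) ` ?D \<Longrightarrow> trace (B ** d) = 0" for B
    proof -
      have "P ** B ** Q = 0"
      proof (rule finite_cover_trace_forms[OF assms(4) R(1) _ R(3)])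
        show "invertible r" if "r \<in> R" for r using that R(2) \<Gamma>inv by blast
        fix d assume "d \<in> ?D"
        have "trace (P ** B ** Q ** d) = trace (P ** (B ** Q ** d))" by (simp add: matrix_mul_assoc)
        also have "\<dots> = trace (B ** Q ** d ** P)" by (rule trace_mul_sym)
        also have "\<dots> = 0" using B[of "Q ** d ** P"] \<open>d \<in> ?D\<close> by (simp add: matrix_mul_assoc)
        finally show "trace (P ** B ** Q ** d) = 0" .
      qed
      moreover have "(Q ** P) ** B ** (Q ** P) = Q ** (P ** B ** Q) ** P"
        by (simp only: matrix_mul_assoc)
      ultimately have "(Q ** P) ** B ** (Q ** P) = 0" by simp
      then show "B = 0" by (simp add: PQ)
    qed
    let ?s = "Q ** \<sigma> i ** P" and ?t = "Q ** t ** P"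
    have conj: "?s ** (Q ** d ** P) ** ?t = Q ** (\<sigma> i ** d ** t) ** P" for d
    proof -
      have "?s ** (Q ** d ** P) ** ?t = Q ** \<sigma> i ** (P ** Q) ** d ** (P ** Q) ** t ** P"
        by (simp only: matrix_mul_assoc)
      then show ?thesis by (simp add: PQ matrix_mul_assoc)
    qed
    \<comment> \<open>An element of \<open>?D\<close> and its conjugate by \<open>\<sigma> i\<close>
      both lie in \<open>\<Delta>\<close>, so both are over \<open>K\<close> in the frame.\<close>
    have st: "?s $ a $ x * ?t $ y $ b \<in> K" for a b x y
    proof (rule conjugation_entries_in_subfield[OF K, where D = "(\<lambda>d. Q ** d ** P) ` ?D"])
      show "B = 0" if "\<And>d. d \<in> (\<lambda>d. Q ** d ** P) ` ?D \<Longrightarrow> trace (B ** d) = 0" for B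
        using that by (rule D)
      show "d \<in> mat_over K" if "d \<in> (\<lambda>d. Q ** d ** P) ` ?D" for d using that \<Delta>K by blast
      show "?s ** d ** ?t \<in> mat_over K" if d: "d \<in> (\<lambda>d. Q ** d ** P) ` ?D" for d
      proof -
        obtain d' where "d' \<in> ?D" "d = Q ** d' ** P" using d by (rule imageE)
        then show ?thesis using conj[of d'] \<Delta>K[of "\<sigma> i ** d' ** t"] by simp
      qed
    qed
    have "?t ** ?s = Q ** t ** (P ** Q) ** \<sigma> i ** P" by (simp only: matrix_mul_assoc)
    also have "\<dots> = mat 1" by (simp add: PQ) (simp add: t PQ flip: matrix_mul_assoc[of Q t])
    finally have ts: "?t ** ?s = mat 1" .
    have "?t \<noteq> 0"
    proof
      assume "?t = 0"
      then have "(mat 1 :: 'f ^ 'd ^ 'd) = 0" using ts by simp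
      then have "(mat 1 :: 'f ^ 'd ^ 'd) $ a $ a = 0" for a by simp
      then show False by (simp add: mat_def)
    qed
    \<comment> \<open>A nonzero entry of the inverse is the scalar \<open>\<tau>\<close>: its
      products with the entries of \<open>?s\<close> are already known to lie in
      \<open>K\<close>.\<close>
    then obtain y b where nz: "?t $ y $ b \<noteq> 0" by (auto simp: vec_eq_iff)
    show ?thesis
    proof (rule scalar_multiple_in_subfield[OF K PQ _ nz])
      show "\<sigma> i \<in> carrier SLpm" using assms(5) i by blast
      show "?t $ y $ b * ?s $ a $ x \<in> K" for a x using st[of a x y b] by (simp add: mult.commute)
      show "trace (\<sigma> i) \<noteq> 0 \<and> trace (\<sigma> i) \<in> K \<or>
          group.ord SLpm (\<sigma> i) \<noteq> 0 \<and> coprime (group.ord SLpm (\<sigma> i)) CARD('d)"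
        using assms(12) i unfolding K_def assms(2) by blast
    qed
  qed
  have \<Gamma>K: "Q ** g ** P \<in> mat_over K" if "g \<in> \<Gamma>" for g
    using that unfolding assms(6)
  proof (induction rule: generate.induct)
    case one
    show ?case using mat_over_one[OF K] by (simp add: SLpm_def PQ)
  next
    case (incl h)
    then show ?case using \<sigma>K by blast
  next
    case (inv h)
    then have h: "Q ** h ** P \<in> mat_over K" using \<sigma>K by blast
    have "h ** inv\<^bsub>SLpm\<^esub> h = mat 1"
      using group.r_inv[OF group_SLpm, of h] inv assms(5) by (auto simp: SLpm_def)
    moreover have "(Q ** h ** P) ** (Q ** inv\<^bsub>SLpm\<^esub> h ** P) = Q ** h ** (P ** Q) ** inv\<^bsub>SLpm\<^esub> h ** P"
      by (simp only: matrix_mul_assoc)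
    ultimately have "(Q ** h ** P) ** (Q ** inv\<^bsub>SLpm\<^esub> h ** P) = mat 1"
      by (simp add: PQ flip: matrix_mul_assoc[of Q h])
    then show ?case by (rule mat_over_right_inverse[OF K h])
  next
    case (eng h1 h2)
    have "Q ** (h1 ** h2) ** P = Q ** (h1 ** (P ** Q) ** h2) ** P" by (simp add: PQ)
    also have "\<dots> = (Q ** h1 ** P) ** (Q ** h2 ** P)" by (simp only: matrix_mul_assoc)
    finally show ?case using mat_over_mult[OF K eng.IH] by (simp add: SLpm_def)
  qed
  \<comment> \<open>The frame coordinates of \<open>g *v v\<close> are in \<open>K\<close> and the
    frame vectors are in \<open>L\<close>, so clearing denominators lands in
    \<open>L\<close>.\<close>
  have denom: "\<exists>d\<in>A. d \<noteq> 0 \<and> d *s (g *v v) \<in> L" if "g \<in> \<Gamma>" "v \<in> L" for g v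
  proof -
    have "(Q *v (g *v v)) $ j \<in> K" for j
    proof -
      have "Q *v (g *v v) = (Q ** g ** P) *v (Q *v v)"
        by (simp add: matrix_vector_mul_assoc) (simp add: PQ flip: matrix_mul_assoc)
      then show ?thesis
        by (auto simp: matrix_vector_mult_def[of "Q ** g ** P"]
            intro!: subfield_set_sum[OF K] subfield_set_mult[OF K] mat_overD[OF \<Gamma>K] QL that)
    qed
    moreover have "g *v v = (\<Sum>j\<in>UNIV. (Q *v (g *v v)) $ j *s column j P)"
    proof -
      have "g *v v = P *v (Q *v (g *v v))" by (simp add: matrix_vector_mul_assoc matrix_mul_assoc PQ)
      then show ?thesis by (metis matrix_mult_sum)
    qed
    ultimately show ?thesis
      using fraction_combination_denominator[OF assms(9) sub finite, of UNIV "\<lambda>j. (Q *v (g *v v)) $ j" "\<lambda>j. column j P"] PL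
      unfolding K_def by simp
  qed
  \<comment> \<open>For conjugation by the identity the intersection is \<open>\<Delta>\<close>
    itself.\<close>
  obtain R where R: "finite R" "R \<subseteq> \<Gamma>" "\<And>g. g \<in> \<Gamma> \<Longrightarrow> \<exists>d\<in>\<Delta>. \<exists>r\<in>R. g = d ** r"
    using cover[OF \<Gamma>(1), of "mat 1"] by auto
  \<comment> \<open>Decomposing the inverse of \<open>g\<close> as \<open>d ** r\<close> and
    inverting turns the cover by right cosets into the cover by left cosets that the orbit module
    needs.\<close>
  define R' where "R' = matrix_inv ` R"
  have inv_eq: "matrix_inv g = h" if "g ** h = mat 1" "h ** g = mat 1" for g h :: "'f ^ 'd ^ 'd"
  proof -
    have "invertible g" using that unfolding invertible_def by blast
    have "matrix_inv g = matrix_inv g ** (g ** h)" using that by simp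
    also have "\<dots> = h" using matrix_mult_inv_left[OF \<open>invertible g\<close>] by (simp add: matrix_mul_assoc)
    finally show ?thesis .
  qed
  show "definable_over A \<Gamma>"
  proof (rule lattice_over_orbit[OF assms(9) L \<Delta>L \<Gamma>(1,2) _ _ _ denom])
    show "finite R'" using R(1) by (simp add: R'_def)
    show "R' \<subseteq> \<Gamma>"
      unfolding R'_def
    proof (rule image_subsetI)
      fix r assume "r \<in> R"
      then obtain h where "h \<in> \<Gamma>" "r ** h = mat 1" "h ** r = mat 1" using R(2) \<Gamma>(3) by blast
      then show "matrix_inv r \<in> \<Gamma>" using inv_eq[of r h] by simp
    qed
    fix g assume "g \<in> \<Gamma>"
    then obtain h where h: "h \<in> \<Gamma>" "g ** h = mat 1" "h ** g = mat 1" using \<Gamma>(3) by blast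
    obtain d r where dr: "d \<in> \<Delta>" "r \<in> R" "h = d ** r" using R(3)[OF h(1)] by blast
    obtain d' where d': "d' \<in> \<Delta>" "d ** d' = mat 1" "d' ** d = mat 1" using \<Delta>(3)[OF dr(1)] by blast
    have r: "matrix_inv r ** r = mat 1" "r ** matrix_inv r = mat 1"
      using R(2) dr(2) \<Gamma>inv matrix_mult_inv_left matrix_mult_inv_right by blast+
    have "h ** (matrix_inv r ** d') = d ** (r ** matrix_inv r) ** d'" by (simp only: dr matrix_mul_assoc)
    then have "h ** (matrix_inv r ** d') = mat 1" by (simp add: r d')
    then have "(g ** h) ** (matrix_inv r ** d') = g" by (simp flip: matrix_mul_assoc)
    then have "g = matrix_inv r ** d'" by (simp add: h)
    then show "\<exists>r\<in>R'. \<exists>d\<in>\<Delta>. g = r ** d" using dr(2) d'(1) unfolding R'_def by blast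
  qed
qed

end
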